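(* Let $\alpha>-1$, $n\in\mathbb N$, $T>0$, $t\in(0,T)$ and $a>0$. In the confluent limit $a_j\to a$, $b_j\to0$, $j=1,\dots,n$, the positions of the $n$ non-intersecting squared Bessel paths (with starting points $a_1<\dots<a_n$ at time $0$ and endpoints $b_1<\dots<b_n$ at time $T$, all positive) at time $t$ are a biorthogonal ensemble: the limit of the joint probability density $\mathcal P_{n,t}$ is of the form $$\frac1{Z_n}\det[f_j(x_k)]_{j,k=1,\dots,n}\,\det[g_j(x_k)]_{j,k=1,\dots,n},\qquad x_1,\dots,x_n>0,$$ with a normalization constant $Z_n$ and functions $$f_{2j-1}(x)=x^{j-1}p_t^\alpha(a,x),\quad j=1,\dots,n_1:=\lceil n/2\rceil,$$ $$f_{2j}(x)=x^{j-1}p_t^{\alpha+1}(a,x),\quad j=1,\dots,n_2:=n-n_1,$$ $$g_j(x)=x^{j-1}e^{-\frac{x}{2(T-t)}},\quad j=1,\dots,n.$$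
   Context: The transition probability density of the squared Bessel process with parameter $\alpha>-1$ is, for $x,y>0$, $$p_t^\alpha(x,y)=\frac1{2t}\left(\frac yx\right)^{\alpha/2}e^{-(x+y)/(2t)}I_\alpha\left(\frac{\sqrt{xy}}t\right),$$ where $I_\alpha(z)=\sum_{k\ge0}\frac{(z/2)^{2k+\alpha}}{k!\,\Gamma(k+\alpha+1)}$ is the modified Bessel function of the first kind. For distinct starting points $a_1<\dots<a_n$ and distinct endpoints $b_1<\dots<b_n$, the positions at time $t\in(0,T)$ of $n$ independent squared Bessel processes, conditioned to start at $a_j$ at time $0$, to end at $b_j$ at time $T$, and not to intersect for $0<t<T$, have the joint probability density on $(0,\infty)^n$ (extended symmetrically) $$\mathcal P_{n,t}(x_1,\dots,x_n)=\frac1{Z_{n,t}}\det[p_t^\alpha(a_j,x_k)]_{j,k=1}^n\det[p_{T-t}^\alpha(x_j,b_k)]_{j,k=1}^n,$$ $Z_{n,t}$ being the normalization constant making $\int_{(0,\infty)^n}\mathcal P_{n,t}=1$. *)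

theory Defs
  imports "HOL-Probability.Probability" "Jordan_Normal_Form.Determinant"
begin

text \<open>Vectors and families are indexed by \<open>{1..n}\<close>; values at other indices are never used.
  \<open>mat\<close> is indexed from 0 (and \<open>Determinant.det\<close> is not the type-indexed \<open>Determinants.det\<close>),
  hence the shift.\<close>

definition det1 :: "nat \<Rightarrow> (nat \<Rightarrow> nat \<Rightarrow> real) \<Rightarrow> real" where
  "det1 n M = Determinant.det (mat n n (\<lambda>(j, k). M (Suc j) (Suc k)))"

definition pos_orthant :: "nat \<Rightarrow> (nat \<Rightarrow> real) set" where
  "pos_orthant n = (\<Pi>\<^sub>E j\<in>{1..n}. {0<..})"

abbreviation lebesgue_n :: "nat \<Rightarrow> (nat \<Rightarrow> real) measure" where
  "lebesgue_n n \<equiv> \<Pi>\<^sub>M j\<in>{1..n}. lborel"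

definition besselI :: "real \<Rightarrow> real \<Rightarrow> real" where
  "besselI \<alpha> z =
    (\<Sum>k. (z / 2) powr (2 * real k + \<alpha>) / (fact k * Gamma (real k + \<alpha> + 1)))"

definition besq_density :: "real \<Rightarrow> real \<Rightarrow> real \<Rightarrow> real \<Rightarrow> real" where
  "besq_density \<alpha> t x y =
    1 / (2 * t) * (y / x) powr (\<alpha> / 2) * exp (- (x + y) / (2 * t)) * besselI \<alpha> (sqrt (x * y) / t)"

definition nonint_weight ::
    "real \<Rightarrow> nat \<Rightarrow> real \<Rightarrow> real \<Rightarrow> (nat \<Rightarrow> real) \<Rightarrow> (nat \<Rightarrow> real) \<Rightarrow> (nat \<Rightarrow> real) \<Rightarrow> real" where
  "nonint_weight \<alpha> n T t A B x =
    det1 n (\<lambda>j k. besq_density \<alpha> t (A j) (x k)) *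
    det1 n (\<lambda>j k. besq_density \<alpha> (T - t) (x j) (B k))"

definition nonint_density ::
    "real \<Rightarrow> nat \<Rightarrow> real \<Rightarrow> real \<Rightarrow> (nat \<Rightarrow> real) \<Rightarrow> (nat \<Rightarrow> real) \<Rightarrow> (nat \<Rightarrow> real) \<Rightarrow> real" where
  "nonint_density \<alpha> n T t A B x =
    1 / (LINT y:pos_orthant n|lebesgue_n n. nonint_weight \<alpha> n T t A B y) *
    nonint_weight \<alpha> n T t A B x"

definition ordered_configs :: "nat \<Rightarrow> (nat \<Rightarrow> real) set" where
  "ordered_configs n = {c. strict_mono_on {1..n} c \<and> (\<forall>j\<in>{1..n}. 0 < c j)}"

text \<open>The limit \<open>a\<^sub>j \<rightarrow> a\<close>, \<open>b\<^sub>j \<rightarrow> 0\<close>, jointly in all \<open>a\<^sub>j\<close>, \<open>b\<^sub>j\<close> with no relation between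
  their rates of convergence. The topology on \<open>nat \<Rightarrow> real\<close> is that of pointwise convergence;
  convergence of the coordinates outside \<open>{1..n}\<close> imposes nothing, since \<open>nonint_density\<close> does
  not depend on them.\<close>

definition confluent :: "nat \<Rightarrow> real \<Rightarrow> ((nat \<Rightarrow> real) \<times> (nat \<Rightarrow> real)) filter" where
  "confluent n a = at (\<lambda>_. a, \<lambda>_. 0) within (ordered_configs n \<times> ordered_configs n)"

definition prob_density_on_orthant :: "nat \<Rightarrow> ((nat \<Rightarrow> real) \<Rightarrow> real) \<Rightarrow> bool" where
  "prob_density_on_orthant n P \<longleftrightarrow>
    (\<forall>x\<in>pos_orthant n. 0 \<le> P x) \<and>
    set_integrable (lebesgue_n n) (pos_orthant n) P \<and>
    (LINT x:pos_orthant n|lebesgue_n n. P x) = 1"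

text \<open>The constant \<open>Z\<close> may be negative, as the order of the functions in the families \<open>f\<close> and
  \<open>g\<close> fixes the sign of the determinants; it is determined by the total mass being 1.\<close>

definition biorthogonal_ensemble ::
    "nat \<Rightarrow> (nat \<Rightarrow> real \<Rightarrow> real) \<Rightarrow> (nat \<Rightarrow> real \<Rightarrow> real) \<Rightarrow> ((nat \<Rightarrow> real) \<Rightarrow> real) \<Rightarrow> bool" where
  "biorthogonal_ensemble n f g P \<longleftrightarrow>
    prob_density_on_orthant n P \<and>
    (\<exists>Z. Z \<noteq> 0 \<and> (\<forall>x\<in>pos_orthant n.
      P x = 1 / Z * det1 n (\<lambda>j k. f j (x k)) * det1 n (\<lambda>j k. g j (x k))))"

end

theory Submission imports Defs begin

text \<open>
  Writing \<open>p(a, x) = const * x powr \<alpha> * exp (- c a - c x) * \<Phi>(c\<^sup>2 a x)\<close> with \<open>c = 1 / (2 t)\<close> and an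
  entire function \<open>\<Phi>\<close> with positive coefficients, both determinants reduce to
  \<open>det \<Phi>(A\<^sub>i y\<^sub>j)\<close>. Newton interpolation at the nodes \<open>A\<^sub>i\<close> splits off the Vandermonde
  factor of \<open>A\<close> exactly and leaves a determinant of divided differences, which stay bounded by
  \<open>\<Phi>(C y)\<close> and converge in the confluent limit. The Vandermonde factors cancel in the normalized
  density, so dominated convergence gives the limit, provided that its total mass does not vanish.
  This follows from the Cauchy--Binet formula: for increasing \<open>A\<close> and \<open>y\<close> every term
  \<open>det (A\<^sub>i ^ \<kappa>\<^sub>j) * det (y\<^sub>i ^ \<kappa>\<^sub>j)\<close> is nonnegative, which bounds the determinant of divided differences
  from below uniformly in \<open>A\<close>. The confluent divided differences are densities of orders
  \<open>\<alpha>, \<alpha> + 1, \<alpha> + 2, \<dots>\<close>, and the three-term recurrence in the order makes them triangular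
  combinations of the functions \<open>f\<^sub>j\<close>.
\<close>

section \<open>Determinants and Newton interpolation\<close>

text \<open>Rows and columns start from 0 here, so that a row number is at once an exponent, a
  number of interpolation nodes and a shift of the Bessel order.\<close>

definition detn :: "nat \<Rightarrow> (nat \<Rightarrow> nat \<Rightarrow> real) \<Rightarrow> real" where
  "detn n M = Determinant.det (mat n n (\<lambda>(i, j). M i j))"

lemma det1_eq_detn: "det1 n M = detn n (\<lambda>i j. M (Suc i) (Suc j))"
  by (simp add: det1_def detn_def)

lemma detn_cong:
  assumes "\<And>i j. i < n \<Longrightarrow> j < n \<Longrightarrow> M i j = N i j"
  shows "detn n M = detn n N"
  unfolding detn_def by (rule arg_cong[of _ _ Determinant.det], rule eq_matI) (auto simp: assms)

lemma permutes_lessThan: "p permutes {..<n} \<Longrightarrow> i < n \<Longrightarrow> p i < (n :: nat)"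
  using permutes_in_image[of p "{..<n}" i] by simp

lemma detn_leibniz:
  "detn n M = (\<Sum>p | p permutes {..<n}. of_int (sign p) * (\<Prod>i<n. M i (p i)))"
proof -
  have "detn n M = (\<Sum>p | p permutes {0..<n}. signof p * (\<Prod>i = 0..<n. mat n n (\<lambda>(i, j). M i j) $$ (i, p i)))"
    unfolding detn_def by (rule det_def') simp
  also have "\<dots> = (\<Sum>p | p permutes {0..<n}. of_int (sign p) * (\<Prod>i<n. M i (p i)))"
    unfolding atLeast0LessThan
    by (intro sum.cong refl arg_cong2[of _ _ _ _ "(*)"] prod.cong)
       (auto simp: permutes_lessThan)
  finally show ?thesis by (simp add: atLeast0LessThan)
qed

lemma detn_transpose: "detn n (\<lambda>i j. M j i) = detn n M"
proof -
  have "detn n M = Determinant.det (transpose_mat (mat n n (\<lambda>(i, j). M i j)))"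
    unfolding detn_def by (rule det_transpose[symmetric, of _ n]) simp
  also have "transpose_mat (mat n n (\<lambda>(i, j). M i j)) = mat n n (\<lambda>(i, j). M j i)"
    by (rule eq_matI) auto
  finally show ?thesis by (simp add: detn_def)
qed

lemma detn_mult: "detn n (\<lambda>i j. \<Sum>k<n. A i k * B k j) = detn n A * detn n B"
proof -
  let ?A = "mat n n (\<lambda>(i, j). A i j)" and ?B = "mat n n (\<lambda>(i, j). B i j)"
  have "mat n n (\<lambda>(i, j). \<Sum>k<n. A i k * B k j) = ?A * ?B"
    by (rule eq_matI) (auto simp: scalar_prod_def atLeast0LessThan)
  then show ?thesis
    by (simp add: detn_def det_mult[of ?A n ?B])
qed

lemma detn_lower_triangular:
  assumes "\<And>i j. i < j \<Longrightarrow> j < n \<Longrightarrow> M i j = 0"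
  shows "detn n M = (\<Prod>i<n. M i i)"
proof -
  have "detn n M = prod_list (diag_mat (mat n n (\<lambda>(i, j). M i j)))"
    unfolding detn_def by (rule det_lower_triangular[of n]) (auto simp: assms)
  also have "\<dots> = (\<Prod>i<n. M i i)"
    by (simp add: prod_list_diag_prod atLeast0LessThan)
  finally show ?thesis .
qed

lemma detn_permute_rows:
  assumes "p permutes {..<n}"
  shows "detn n (\<lambda>i j. M (p i) j) = of_int (sign p) * detn n M"
proof -
  let ?M = "mat n n (\<lambda>(i, j). M i j)"
  have "detn n (\<lambda>i j. M (p i) j) = Determinant.det (mat n n (\<lambda>(i, j). ?M $$ (p i, j)))"
    unfolding detn_def using permutes_in_image[OF assms]
    by (intro arg_cong[of _ _ Determinant.det] eq_matI) auto
  also have "\<dots> = signof p * Determinant.det ?M"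
    using assms by (intro det_permute_rows) (auto simp: atLeast0LessThan)
  finally show ?thesis by (simp add: detn_def)
qed

lemma detn_permute_cols:
  assumes "p permutes {..<n}"
  shows "detn n (\<lambda>i j. M i (p j)) = of_int (sign p) * detn n M"
  using detn_permute_rows[OF assms, of "\<lambda>i j. M j i"]
  by (simp only: detn_transpose[of n M] detn_transpose[of n "\<lambda>i j. M i (p j)"])

lemma detn_scale: "detn n (\<lambda>i j. r i * s j * M i j) = (\<Prod>i<n. r i) * (\<Prod>j<n. s j) * detn n M"
proof -
  have "(\<Prod>i<n. r i * s (p i) * M i (p i)) = (\<Prod>i<n. r i) * (\<Prod>j<n. s j) * (\<Prod>i<n. M i (p i))"
    if "p permutes {..<n}" for p
    using prod.permute[OF that, of s] by (simp add: prod.distrib o_def)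
  then show ?thesis
    by (simp add: detn_leibniz sum_distrib_left mult_ac)
qed

lemma detn_eq_0_kernel:
  assumes "detn n M = 0"
  shows "\<exists>v. (\<exists>j<n. v j \<noteq> 0) \<and> (\<forall>i<n. (\<Sum>j<n. M i j * v j) = 0)"
proof -
  let ?M = "mat n n (\<lambda>(i, j). M i j)"
  obtain v where v: "v \<in> carrier_vec n" "v \<noteq> 0\<^sub>v n" "?M *\<^sub>v v = 0\<^sub>v n"
    using assms det_0_iff_vec_prod_zero[of ?M n] by (auto simp: detn_def)
  have "\<exists>j<n. vec_index v j \<noteq> 0"
    using v(1,2) by (metis carrier_vecD eq_vecI index_zero_vec(1) index_zero_vec(2))
  moreover have "(\<Sum>j<n. M i j * vec_index v j) = 0" if "i < n" for i
  proof -
    have "vec_index (?M *\<^sub>v v) i = 0" using v(3) that by simp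
    then show ?thesis using that v(1) by (simp add: scalar_prod_def atLeast0LessThan)
  qed
  ultimately show ?thesis by blast
qed

lemma detn_eq_0_cols:
  assumes "k < n" "l < n" "k \<noteq> l" "\<And>i. i < n \<Longrightarrow> M i k = M i l"
  shows "detn n M = 0"
proof -
  let ?p = "Transposition.transpose k l"
  have p: "?p permutes {..<n}"
    using assms by (intro permutes_swap_id) auto
  have "detn n M = detn n (\<lambda>i j. M i (?p j))"
    using assms by (intro detn_cong) (auto simp: Transposition.transpose_def)
  also have "\<dots> = - detn n M"
    using assms(3) by (simp add: detn_permute_cols[OF p] sign_swap_id)
  finally show ?thesis by simp
qed

lemma tendsto_detn:
  assumes "\<And>i j. i < n \<Longrightarrow> j < n \<Longrightarrow> ((\<lambda>x. M x i j) \<longlongrightarrow> N i j) F"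
  shows "((\<lambda>x. detn n (M x)) \<longlongrightarrow> detn n N) F"
  unfolding detn_leibniz
  by (intro tendsto_sum tendsto_mult tendsto_const tendsto_prod assms)
     (auto simp: permutes_lessThan)

text \<open>Leibniz expansion with a bound depending on the column only. The columns will belong to
  the integration variables, so this yields a product of one-variable functions.\<close>

lemma abs_detn_le:
  assumes "\<And>i j. i < n \<Longrightarrow> j < n \<Longrightarrow> \<bar>M i j\<bar> \<le> b j"
  shows "\<bar>detn n M\<bar> \<le> fact n * (\<Prod>j<n. b j)"
proof -
  have "\<bar>of_int (sign p) * (\<Prod>i<n. M i (p i))\<bar> \<le> (\<Prod>j<n. b j)" if p: "p permutes {..<n}" for p
  proof -
    have "\<bar>of_int (sign p) * (\<Prod>i<n. M i (p i))\<bar> = (\<Prod>i<n. \<bar>M i (p i)\<bar>)"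
      by (simp add: abs_mult abs_prod sign_def)
    also have "\<dots> \<le> (\<Prod>i<n. b (p i))"
      using permutes_in_image[OF p] by (intro prod_mono) (auto simp: assms)
    also have "\<dots> = (\<Prod>j<n. b j)"
      using prod.permute[OF p, of b] by (simp add: o_def)
    finally show ?thesis .
  qed
  then have "\<bar>detn n M\<bar> \<le> (\<Sum>p | p permutes {..<n}. (\<Prod>j<n. b j))"
    unfolding detn_leibniz by (intro order.trans[OF sum_abs] sum_mono) auto
  also have "\<dots> = fact n * (\<Prod>j<n. b j)"
    using card_permutations[of "{..<n}" n] by simp
  finally show ?thesis .
qed

text \<open>The divided difference of \<open>z ^ p\<close> at the nodes \<open>A 0, \<dots>, A i\<close>, i.e. the complete homogeneous
  symmetric polynomial of degree \<open>p - i\<close> in them (0 if \<open>p < i\<close>).\<close>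

fun newton :: "(nat \<Rightarrow> real) \<Rightarrow> nat \<Rightarrow> nat \<Rightarrow> real" where
  "newton A 0 i = (if i = 0 then 1 else 0)"
| "newton A (Suc p) i = A i * newton A p i + (if i = 0 then 0 else newton A p (i - 1))"

lemma newton_eq_0: "p < i \<Longrightarrow> newton A p i = 0"
  by (induction p arbitrary: i) auto

lemma newton_diag: "newton A p p = 1"
  by (induction p) (auto simp: newton_eq_0)

text \<open>Newton interpolation of \<open>z ^ p\<close>, evaluated at the node \<open>A j\<close>:
  summands with \<open>i > j\<close> contain the factor \<open>A j - A j\<close>, so every length
  beyond \<open>j\<close> gives the same sum. The induction splits \<open>A j\<close> as
  \<open>A i + (A j - A i)\<close>; the second part turns one Newton basis value into the
  next.\<close>

lemma newton_expansion:
  assumes "j < n"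
  shows "A j ^ p = (\<Sum>i<n. (\<Prod>l<i. A j - A l) * newton A p i)"
proof (induction p)
  case 0
  show ?case using assms by (simp add: if_distrib cong: if_cong)
next
  case (Suc p)
  define N where "N i = (\<Prod>l<i. A j - A l)" for i
  obtain m where m: "n = Suc m" using assms by (cases n) auto
  \<comment> \<open>This lets the shifted sum below run up to \<open>n\<close> instead of
    \<open>m\<close>.\<close>
  have Nn: "N n = 0" using assms by (auto simp: N_def)
  have "(\<Sum>i<n. N i * newton A (Suc p) i) =
        (\<Sum>i<n. N i * A i * newton A p i) + (\<Sum>i<n. if i = 0 then 0 else N i * newton A p (i - 1))"
    by (simp add: sum.distrib[symmetric] algebra_simps) (rule sum.cong, auto simp: algebra_simps)
  also have "(\<Sum>i<n. if i = 0 then 0 else N i * newton A p (i - 1)) = (\<Sum>i<m. N (Suc i) * newton A p i)"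
    unfolding m by (subst sum.lessThan_Suc_shift) simp
  also have "\<dots> = (\<Sum>i<n. N (Suc i) * newton A p i)"
    using Nn by (simp add: m)
  also have "(\<Sum>i<n. N i * A i * newton A p i) + \<dots> = (\<Sum>i<n. A j * (N i * newton A p i))"
    unfolding sum.distrib[symmetric] by (rule sum.cong) (auto simp: N_def algebra_simps)
  finally show ?case
    using Suc.IH by (simp add: N_def sum_distrib_left)
qed

text \<open>Each step of the recursion multiplies the bound by at most \<open>M + 1\<close>. A bound
  geometric in \<open>p\<close> suffices, since the coefficients of an entire series absorb
  it.\<close>

lemma abs_newton_le:
  assumes "\<And>j. j \<le> i \<Longrightarrow> \<bar>A j\<bar> \<le> M"
  shows "\<bar>newton A p i\<bar> \<le> (1 + M) ^ p"
  using assms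
proof (induction p arbitrary: i)
  case (Suc p)
  have M: "0 \<le> M" using Suc.prems[of 0] by linarith
  have "\<bar>newton A (Suc p) i\<bar> \<le> \<bar>A i\<bar> * \<bar>newton A p i\<bar> + \<bar>if i = 0 then 0 else newton A p (i - 1)\<bar>"
    by (auto simp: abs_mult[symmetric] intro: abs_triangle_ineq)
  also have "\<dots> \<le> M * (1 + M) ^ p + (1 + M) ^ p"
    using Suc M by (intro add_mono mult_mono) auto
  finally show ?case by (simp add: algebra_simps)
qed auto

text \<open>At coinciding nodes a divided difference is a Taylor coefficient: the
  \<open>i\<close>-th derivative of \<open>z ^ p\<close> at \<open>a\<close>, divided by
  \<open>i!\<close>. For \<open>p < i\<close> the binomial coefficient vanishes, so the truncated
  exponent does no harm.\<close>

lemma newton_const: "newton (\<lambda>_. a) p i = real (p choose i) * a ^ (p - i)"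
proof (induction p arbitrary: i)
  case (Suc p)
  show ?case
  proof (cases i)
    case (Suc m)
    have "a * (real (p choose Suc m) * a ^ (p - Suc m)) = real (p choose Suc m) * a ^ (p - m)"
    proof (cases "m < p")
      case True
      then have "p - m = Suc (p - Suc m)" by simp
      then show ?thesis by simp
    qed (simp add: binomial_eq_0)
    then show ?thesis by (simp add: Suc.IH Suc algebra_simps)
  qed (simp add: Suc.IH)
qed (auto simp: binomial_eq_0)

lemma tendsto_newton:
  assumes "\<And>j. j \<le> i \<Longrightarrow> ((\<lambda>x. A x j) \<longlongrightarrow> B j) F"
  shows "((\<lambda>x. newton (A x) p i) \<longlongrightarrow> newton B p i) F"
  using assms
proof (induction p arbitrary: i)
  case (Suc p)
  then show ?case by (cases "i = 0") (auto intro!: tendsto_intros)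
qed auto

section \<open>Vandermonde determinants\<close>

definition vand :: "nat \<Rightarrow> (nat \<Rightarrow> real) \<Rightarrow> real" where
  "vand n A = (\<Prod>j<n. \<Prod>l<j. A j - A l)"

text \<open>\<open>M\<close> is a matrix product: the Newton basis values at the nodes form a lower
  triangular matrix whose diagonal multiplies to \<open>vand n A\<close>, and the other factor is
  \<open>E\<close>.\<close>

lemma detn_newton_factor:
  assumes "\<And>i j. i < n \<Longrightarrow> j < n \<Longrightarrow> M i j = (\<Sum>k<n. (\<Prod>l<k. A i - A l) * E k j)"
  shows "detn n M = vand n A * detn n E"
proof -
  have "detn n M = detn n (\<lambda>i k. \<Prod>l<k. A i - A l) * detn n E"
    by (subst detn_mult[symmetric], rule detn_cong) (simp add: assms)
  also have "detn n (\<lambda>i k. \<Prod>l<k. A i - A l) = vand n A"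
    unfolding vand_def by (rule detn_lower_triangular) auto
  finally show ?thesis .
qed

text \<open>For monomials the divided differences form a unitriangular matrix.\<close>

lemma detn_vandermonde: "detn n (\<lambda>i k. A i ^ k) = vand n A"
proof -
  have "detn n (\<lambda>i k. A i ^ k) = vand n A * detn n (\<lambda>i p. newton A p i)"
    by (rule detn_newton_factor) (rule newton_expansion)
  also have "detn n (\<lambda>i p. newton A p i) = detn n (\<lambda>p i. newton A p i)"
    by (rule detn_transpose)
  also have "\<dots> = 1"
    by (subst detn_lower_triangular) (auto simp: newton_eq_0 newton_diag)
  finally show ?thesis by simp
qed

lemma vand_pos:
  assumes "strict_mono_on {..<n} A"
  shows "0 < vand n A"
  unfolding vand_def using assms
  by (intro prod_pos) (auto simp: strict_mono_on_def)

lemma vand_permute: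
  assumes "p permutes {..<n}"
  shows "vand n (\<lambda>i. A (p i)) = of_int (sign p) * vand n A"
  using detn_permute_rows[OF assms, of "\<lambda>i k. A i ^ k"] by (simp add: detn_vandermonde)

lemma vand_eq_0:
  assumes "\<not> inj_on A {..<n}"
  shows "vand n A = 0"
proof -
  obtain k l where "k < n" "l < n" "k \<noteq> l" "A k = A l"
    using assms by (auto simp: inj_on_def)
  then show ?thesis
    using detn_eq_0_cols[of k n l "\<lambda>j i. A i ^ j"] detn_transpose[of n "\<lambda>i j. A i ^ j"]
    by (simp add: detn_vandermonde)
qed

section \<open>Total positivity\<close>

text \<open>By Rolle's theorem, after division by one of the exponentials.\<close>

lemma exp_sum_zero:
  fixes c \<kappa> :: "'i \<Rightarrow> real" and u :: "nat \<Rightarrow> real"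
  assumes "finite I" "inj_on \<kappa> I"
    and "\<And>k. Suc k < card I \<Longrightarrow> u k < u (Suc k)"
    and "\<And>k. k < card I \<Longrightarrow> (\<Sum>i\<in>I. c i * exp (\<kappa> i * u k)) = 0"
    and "i \<in> I"
  shows "c i = 0"
  using assms
proof (induction I arbitrary: c \<kappa> u i rule: finite_induct)
  case (insert i0 I)
  have card: "card (insert i0 I) = Suc (card I)" using insert.hyps by simp
  define g where "g x = c i0 + (\<Sum>i\<in>I. c i * exp ((\<kappa> i - \<kappa> i0) * x))" for x
  have g: "g x = exp (- \<kappa> i0 * x) * (\<Sum>i\<in>insert i0 I. c i * exp (\<kappa> i * x))" for x
    using insert.hyps
    by (simp add: g_def distrib_left sum_distrib_left exp_minus exp_diff left_diff_distrib field_simps)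
  have gz: "g (u k) = 0" if "k < Suc (card I)" for k
    using insert.prems(3)[of k] that card by (simp add: g)
  have g': "(g has_real_derivative (\<Sum>i\<in>I. c i * (\<kappa> i - \<kappa> i0) * exp ((\<kappa> i - \<kappa> i0) * x))) (at x)" for x
    unfolding g_def by (auto intro!: derivative_eq_intros sum.cong simp: algebra_simps)
  \<comment> \<open>Each gap between consecutive zeros of \<open>g\<close> contains a zero of its
    derivative, in which the constant term of \<open>i0\<close> is gone: \<open>card I\<close> terms
    are left with \<open>card I\<close> zeros.\<close>
  have "\<exists>w. u k < w \<and> w < u (Suc k) \<and> (\<Sum>i\<in>I. c i * (\<kappa> i - \<kappa> i0) * exp ((\<kappa> i - \<kappa> i0) * w)) = 0"
    if "k < card I" for k
  proof -
    have "\<exists>z. u k < z \<and> z < u (Suc k) \<and> DERIV g z :> 0"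
    proof (rule Rolle)
      show "u k < u (Suc k)" using that card insert.prems(2)[of k] by simp
      show "g (u k) = g (u (Suc k))" using that gz by simp
      show "continuous_on {u k..u (Suc k)} g"
        by (intro continuous_at_imp_continuous_on ballI DERIV_isCont[OF g'])
      show "g differentiable at x" for x
        using g' real_differentiable_def by blast
    qed
    then obtain z where z: "u k < z" "z < u (Suc k)" "DERIV g z :> 0" by blast
    show ?thesis using DERIV_unique[OF g' z(3)] z(1,2) by blast
  qed
  then have "\<forall>k\<in>{..<card I}. \<exists>w. u k < w \<and> w < u (Suc k) \<and>
      (\<Sum>i\<in>I. c i * (\<kappa> i - \<kappa> i0) * exp ((\<kappa> i - \<kappa> i0) * w)) = 0"
    by blast
  from bchoice[OF this] obtain w where w: "\<And>k. k < card I \<Longrightarrow> u k < w k" "\<And>k. k < card I \<Longrightarrow> w k < u (Suc k)"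
    "\<And>k. k < card I \<Longrightarrow> (\<Sum>i\<in>I. c i * (\<kappa> i - \<kappa> i0) * exp ((\<kappa> i - \<kappa> i0) * w k)) = 0"
    by auto
  \<comment> \<open>Exponents shifted by \<open>\<kappa> i0\<close> stay distinct, and the factors
    brought in by differentiation are nonzero, so nothing is lost in passing to the
    derivative.\<close>
  have "c i * (\<kappa> i - \<kappa> i0) = 0" if "i \<in> I" for i
  proof (rule insert.IH[where c = "\<lambda>i. c i * (\<kappa> i - \<kappa> i0)" and \<kappa> = "\<lambda>i. \<kappa> i - \<kappa> i0" and u = w])
    show "inj_on (\<lambda>i. \<kappa> i - \<kappa> i0) I" using insert.prems(1) by (auto simp: inj_on_def)
    show "w k < w (Suc k)" if "Suc k < card I" for k
      using w(2)[of k] w(1)[of "Suc k"] that by simp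
  qed (use w(3) that in auto)
  moreover have "\<kappa> i \<noteq> \<kappa> i0" if "i \<in> I" for i
    using insert.prems(1) insert.hyps(2) that by (auto simp: inj_on_def)
  ultimately have cI: "c i = 0" if "i \<in> I" for i
    using that by fastforce
  then have "c i0 = 0" using gz[of 0] by (simp add: g_def)
  then show ?case using cI insert.prems(4) by auto
qed auto

text \<open>A nonzero kernel vector would give a combination of \<open>n\<close> powers with
  \<open>n\<close> positive zeros. In the variable \<open>ln y\<close> it is a sum of exponentials,
  excluded by \<open>exp_sum_zero\<close>.\<close>

lemma gen_vandermonde_nonzero:
  fixes \<kappa> :: "nat \<Rightarrow> nat"
  assumes "strict_mono_on {..<n} y" "\<And>i. i < n \<Longrightarrow> 0 < y i" "inj_on \<kappa> {..<n}"
  shows "detn n (\<lambda>i j. y i ^ \<kappa> j) \<noteq> 0"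
proof
  assume "detn n (\<lambda>i j. y i ^ \<kappa> j) = 0"
  then obtain v where v: "\<exists>j<n. v j \<noteq> 0" "\<And>i. i < n \<Longrightarrow> (\<Sum>j<n. y i ^ \<kappa> j * v j) = 0"
    using detn_eq_0_kernel by blast
  have "v j = 0" if "j < n" for j
  proof (rule exp_sum_zero[of "{..<n}" "\<lambda>j. real (\<kappa> j)" "\<lambda>i. ln (y i)"])
    show "inj_on (\<lambda>j. real (\<kappa> j)) {..<n}" using assms(3) by (auto simp: inj_on_def)
    show "ln (y k) < ln (y (Suc k))" if "Suc k < card {..<n}" for k
      using that assms(1,2) by (auto simp: strict_mono_on_def)
    show "(\<Sum>j<n. v j * exp (real (\<kappa> j) * ln (y k))) = 0" if "k < card {..<n}" for k
      using v(2)[of k] that assms(2)[of k]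
      by (simp add: exp_of_nat_mult mult.commute)
  qed (use that in auto)
  then show False using v(1) by blast
qed

text \<open>The determinant cannot change sign along the segment from \<open>A\<close> to \<open>y\<close>, where it does not vanish.\<close>

lemma gen_vandermonde_same_sign:
  fixes \<kappa> :: "nat \<Rightarrow> nat"
  assumes A: "strict_mono_on {..<n} A" "\<And>i. i < n \<Longrightarrow> 0 < A i"
    and y: "strict_mono_on {..<n} y" "\<And>i. i < n \<Longrightarrow> 0 < y i"
  shows "0 \<le> detn n (\<lambda>i j. A i ^ \<kappa> j) * detn n (\<lambda>i j. y i ^ \<kappa> j)"
proof (cases "inj_on \<kappa> {..<n}")
  case True
  define z where "z s i = (1 - s) * A i + s * y i" for s i
  define D where "D s = detn n (\<lambda>i j. z s i ^ \<kappa> j)" for s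
  have nz: "D s \<noteq> 0" if "s \<in> {0..1}" for s
    unfolding D_def
  proof (rule gen_vandermonde_nonzero[OF _ _ True])
    \<comment> \<open>Needed twice: the points on the segment and their increments are both convex
      combinations of positive numbers.\<close>
    have mix: "0 < (1 - s) * p + s * q" if "0 < p" "0 < q" for p q :: real
    proof (cases "s = 0")
      case False
      then have "0 < s * q" "0 \<le> (1 - s) * p" using \<open>s \<in> {0..1}\<close> that by auto
      then show ?thesis by linarith
    qed (use that in auto)
    show "0 < z s i" if "i < n" for i
      unfolding z_def using mix that A y by blast
    show "strict_mono_on {..<n} (z s)"
    proof (rule strict_mono_onI)
      fix i j assume "i \<in> {..<n}" "j \<in> {..<n}" "i < j"
      then have "0 < (1 - s) * (A j - A i) + s * (y j - y i)"
        using A(1) y(1) by (intro mix) (auto simp: strict_mono_on_def)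
      then show "z s i < z s j" by (simp add: z_def algebra_simps)
    qed
  qed
  have cont: "continuous_on {0..1} D"
    unfolding continuous_on_def D_def z_def by (auto intro!: tendsto_detn tendsto_intros)
  have "0 \<le> D 0 * D 1"
  proof (rule ccontr)
    assume "\<not> 0 \<le> D 0 * D 1"
    then consider "D 0 \<le> 0" "0 \<le> D 1" | "D 1 \<le> 0" "0 \<le> D 0"
      by (auto simp: zero_le_mult_iff)
    then have "\<exists>s\<ge>0. s \<le> 1 \<and> D s = 0"
      using IVT'[of D 0 0 1] IVT2'[of D 1 0 0] cont by cases auto
    then show False using nz by auto
  qed
  then show ?thesis by (simp add: D_def z_def)
next
  case False
  then obtain k l where "k < n" "l < n" "k \<noteq> l" "\<kappa> k = \<kappa> l"
    by (auto simp: inj_on_def)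
  then have "detn n (\<lambda>i j. A i ^ \<kappa> j) = 0"
    by (intro detn_eq_0_cols[of k n l]) auto
  then show ?thesis by simp
qed

section \<open>The Cauchy-Binet formula and lower bounds for determinants of power series\<close>

text \<open>The sum runs over all maps, not only increasing ones, whence the factor
  \<open>fact n\<close>: noninjective maps contribute zero, and each set of \<open>n\<close> indices
  is counted once per ordering.\<close>

lemma cauchy_binet:
  fixes w :: "'k \<Rightarrow> real"
  assumes "finite K"
  shows "fact n * detn n (\<lambda>i j. \<Sum>q\<in>K. w q * A i q * B j q) =
    (\<Sum>\<kappa>\<in>{..<n} \<rightarrow>\<^sub>E K. (\<Prod>i<n. w (\<kappa> i)) * detn n (\<lambda>i j. A i (\<kappa> j)) * detn n (\<lambda>i j. B i (\<kappa> j)))"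
proof -
  define X where "X = ({..<n} \<rightarrow>\<^sub>E K)"
  \<comment> \<open>The outcome of expanding the left determinant: the determinant of
    \<open>B\<close> is assembled already, while \<open>A\<close> contributes only its diagonal
    product.\<close>
  define F where "F \<kappa> = (\<Prod>i<n. w (\<kappa> i)) * (\<Prod>i<n. A i (\<kappa> i)) * detn n (\<lambda>i j. B i (\<kappa> j))" for \<kappa>
  have det: "detn n (\<lambda>i j. \<Sum>q\<in>K. w q * A i q * B j q) = (\<Sum>\<kappa>\<in>X. F \<kappa>)"
  proof -
    have "detn n (\<lambda>i j. \<Sum>q\<in>K. w q * A i q * B j q) =
        (\<Sum>p | p permutes {..<n}. \<Sum>\<kappa>\<in>X. of_int (sign p) *
          (\<Prod>i<n. w (\<kappa> i) * A i (\<kappa> i) * B (p i) (\<kappa> i)))"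
      unfolding detn_leibniz X_def using assms
      by (subst prod_sum_PiE) (auto simp: sum_distrib_left)
    also have "\<dots> = (\<Sum>\<kappa>\<in>X. \<Sum>p | p permutes {..<n}. of_int (sign p) *
          (\<Prod>i<n. w (\<kappa> i) * A i (\<kappa> i) * B (p i) (\<kappa> i)))"
      by (rule sum.swap)
    also have "\<dots> = (\<Sum>\<kappa>\<in>X. F \<kappa>)"
    proof (rule sum.cong[OF refl])
      fix \<kappa>
      have "detn n (\<lambda>i j. B i (\<kappa> j)) = detn n (\<lambda>i j. B j (\<kappa> i))"
        by (rule detn_transpose)
      then show "(\<Sum>p | p permutes {..<n}. of_int (sign p) *
          (\<Prod>i<n. w (\<kappa> i) * A i (\<kappa> i) * B (p i) (\<kappa> i))) = F \<kappa>"
        unfolding F_def detn_leibniz[of n "\<lambda>i j. B j (\<kappa> i)"]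
        by (simp add: sum_distrib_left prod.distrib mult_ac)
    qed
    finally show ?thesis .
  qed
  \<comment> \<open>Precomposition with \<open>p\<close> permutes the maps and draws the sign of
    \<open>p\<close> from the determinant of \<open>B\<close>; what remains of \<open>A\<close> is
    then one Leibniz term of its determinant.\<close>
  have reindex: "(\<Sum>\<kappa>\<in>X. F \<kappa>) = (\<Sum>\<kappa>\<in>X. (\<Prod>i<n. w (\<kappa> i)) * detn n (\<lambda>i j. B i (\<kappa> j)) *
      (of_int (sign p) * (\<Prod>i<n. A i (\<kappa> (p i)))))" if p: "p permutes {..<n}" for p
  proof -
    have bij: "bij_betw (\<lambda>\<kappa>. \<kappa> \<circ> p) X X"
    proof (rule bij_betwI[of _ _ _ "\<lambda>\<kappa>. \<kappa> \<circ> Hilbert_Choice.inv p"])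
      show "(\<lambda>\<kappa>. \<kappa> \<circ> p) \<in> X \<rightarrow> X" "(\<lambda>\<kappa>. \<kappa> \<circ> Hilbert_Choice.inv p) \<in> X \<rightarrow> X"
        using permutes_in_image[OF p] permutes_not_in[OF p]
          permutes_in_image[OF permutes_inv[OF p]] permutes_not_in[OF permutes_inv[OF p]]
        by (auto simp: X_def PiE_def Pi_def extensional_def)
    qed (auto simp: fun_eq_iff permutes_inverses[OF p])
    have "F (\<kappa> \<circ> p) = (\<Prod>i<n. w (\<kappa> i)) * detn n (\<lambda>i j. B i (\<kappa> j)) *
      (of_int (sign p) * (\<Prod>i<n. A i (\<kappa> (p i))))" for \<kappa>
      using prod.permute[OF p, of "\<lambda>i. w (\<kappa> i)"] detn_permute_cols[OF p, of "\<lambda>i j. B i (\<kappa> j)"]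
      by (simp add: F_def o_def)
    then show ?thesis
      by (subst sum.reindex_bij_betw[OF bij, symmetric]) simp
  qed
  have leib: "detn n (\<lambda>i j. A i (\<kappa> j)) =
      (\<Sum>p | p permutes {..<n}. of_int (sign p) * (\<Prod>i<n. A i (\<kappa> (p i))))" for \<kappa>
    by (rule detn_leibniz)
  \<comment> \<open>Adding up the \<open>fact n\<close> equal expressions, one for each permutation,
    completes the determinant of \<open>A\<close>.\<close>
  have "fact n * (\<Sum>\<kappa>\<in>X. F \<kappa>) = (\<Sum>p | p permutes {..<n}. \<Sum>\<kappa>\<in>X. F \<kappa>)"
    using card_permutations[of "{..<n}" n] by simp
  also have "\<dots> = (\<Sum>p | p permutes {..<n}. \<Sum>\<kappa>\<in>X. (\<Prod>i<n. w (\<kappa> i)) * detn n (\<lambda>i j. B i (\<kappa> j)) *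
      (of_int (sign p) * (\<Prod>i<n. A i (\<kappa> (p i)))))"
    by (rule sum.cong[OF refl]) (simp add: reindex)
  also have "\<dots> = (\<Sum>\<kappa>\<in>X. (\<Prod>i<n. w (\<kappa> i)) * detn n (\<lambda>i j. B i (\<kappa> j)) * detn n (\<lambda>i j. A i (\<kappa> j)))"
    by (subst sum.swap, rule sum.cong[OF refl])
       (simp add: leib sum_distrib_left)
  finally show ?thesis
    unfolding det X_def[symmetric] by (simp add: mult_ac)
qed

text \<open>By Cauchy-Binet, a truncation of the series gives a sum of products of generalized
  Vandermonde determinants in \<open>A\<close> and in \<open>y\<close>. All are nonnegative, and one
  of them is the product of the ordinary ones; the bound passes to the limit.\<close>

lemma detn_series_ge:
  assumes w: "\<And>p. 0 \<le> w p"
    and A: "strict_mono_on {..<n} A" "\<And>i. i < n \<Longrightarrow> 0 < A i"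
    and y: "strict_mono_on {..<n} y" "\<And>i. i < n \<Longrightarrow> 0 < y i"
    and S: "\<And>i j. i < n \<Longrightarrow> j < n \<Longrightarrow> (\<lambda>p. w p * (A i * y j) ^ p) sums M i j"
  shows "(\<Prod>i<n. w i) / fact n * vand n A * vand n y \<le> detn n M"
proof (rule LIMSEQ_le_const)
  show "(\<lambda>N. detn n (\<lambda>i j. \<Sum>p<N. w p * (A i * y j) ^ p)) \<longlonglongrightarrow> detn n M"
    using S by (intro tendsto_detn) (auto simp: sums_def)
  have "(\<Prod>i<n. w i) / fact n * vand n A * vand n y \<le> detn n (\<lambda>i j. \<Sum>p<N. w p * (A i * y j) ^ p)"
    if "n \<le> N" for N
  proof -
    let ?t = "\<lambda>\<kappa>. (\<Prod>i<n. w (\<kappa> i)) * detn n (\<lambda>i j. A i ^ \<kappa> j) * detn n (\<lambda>i j. y i ^ \<kappa> j)"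
    \<comment> \<open>Only the term of the exponents \<open>0, \<dots>, n - 1\<close> in one of their \<open>n!\<close> orderings is kept.\<close>
    let ?k = "restrict id {..<n}"
    have "?t ?k = (\<Prod>i<n. w i) * vand n A * vand n y"
      unfolding detn_vandermonde[symmetric]
      by (intro arg_cong2[of _ _ _ _ "(*)"] prod.cong detn_cong) auto
    then have "(\<Prod>i<n. w i) * vand n A * vand n y = ?t ?k" by (rule sym)
    also have "\<dots> \<le> (\<Sum>\<kappa>\<in>{..<n} \<rightarrow>\<^sub>E {..<N}. ?t \<kappa>)"
    proof (rule member_le_sum)
      show "0 \<le> ?t \<kappa>" for \<kappa>
        using mult_nonneg_nonneg[OF prod_nonneg[of "{..<n}" "\<lambda>i. w (\<kappa> i)"]
            gen_vandermonde_same_sign[OF A y, of \<kappa>]] w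
        by (simp add: mult.assoc)
      show "?k \<in> {..<n} \<rightarrow>\<^sub>E {..<N}" using that by auto
      show "finite ({..<n} \<rightarrow>\<^sub>E {..<N})" by (intro finite_PiE) auto
    qed
    also have "\<dots> = fact n * detn n (\<lambda>i j. \<Sum>p<N. w p * A i ^ p * y j ^ p)"
      by (rule cauchy_binet[symmetric]) simp
    finally show ?thesis
      by (simp add: field_simps power_mult_distrib)
  qed
  then show "\<exists>N. \<forall>N'\<ge>N. (\<Prod>i<n. w i) / fact n * vand n A * vand n y
      \<le> detn n (\<lambda>i j. \<Sum>p<N'. w p * (A i * y j) ^ p)" by blast
qed

lemma ex_sorting_permutation:
  fixes y :: "nat \<Rightarrow> 'a :: linorder"
  assumes "inj_on y {..<n}"
  obtains p where "p permutes {..<n}" "strict_mono_on {..<n} (\<lambda>i. y (p i))"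
proof -
  define L where "L = sorted_list_of_set (y ` {..<n})"
  have L: "sorted_wrt (<) L" "set L = y ` {..<n}" "length L = n" "distinct L"
    using assms by (auto simp: L_def card_image)
  define p where "p i = (if i < n then inv_into {..<n} y (L ! i) else i)" for i
  have mem: "L ! i \<in> y ` {..<n}" if "i < n" for i
    using L that nth_mem by metis
  have yp: "y (p i) = L ! i" if "i < n" for i
    using mem[OF that] that by (simp add: p_def f_inv_into_f)
  have pn: "p i < n" if "i < n" for i
    using inv_into_into[OF mem[OF that]] that by (simp add: p_def)
  have inj: "inj_on p {..<n}"
    by (rule inj_onI) (metis L(3,4) lessThan_iff nth_eq_iff_index_eq yp)
  have "p ` {..<n} = {..<n}"
    using inj pn by (intro card_subset_eq) (auto simp: card_image)
  then have "p permutes {..<n}"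
    using inj by (intro bij_imp_permutes) (auto simp: bij_betw_def p_def)
  moreover have "strict_mono_on {..<n} (\<lambda>i. y (p i))"
    using L(1,3) by (auto simp: strict_mono_on_def yp sorted_wrt_iff_nth_less)
  ultimately show ?thesis by (rule that)
qed

text \<open>The extra factor \<open>vand n y\<close> makes both sides symmetric in \<open>y\<close>,
  since the two determinants on the right change sign together; so \<open>y\<close> may be sorted.
  Repeated values make both sides zero.\<close>

lemma detn_series_vand_ge:
  assumes w: "\<And>p. 0 \<le> w p"
    and A: "strict_mono_on {..<n} A" "\<And>i. i < n \<Longrightarrow> 0 < A i"
    and y: "\<And>i. i < n \<Longrightarrow> 0 < y i"
    and S: "\<And>i j. i < n \<Longrightarrow> j < n \<Longrightarrow> (\<lambda>p. w p * (A i * y j) ^ p) sums M i j"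
  shows "(\<Prod>i<n. w i) / fact n * vand n A * (vand n y)\<^sup>2 \<le> detn n M * vand n y"
proof (cases "inj_on y {..<n}")
  case True
  then obtain p where p: "p permutes {..<n}" "strict_mono_on {..<n} (\<lambda>i. y (p i))"
    by (rule ex_sorting_permutation)
  have pn: "p i < n" if "i < n" for i
    using permutes_in_image[OF p(1)] that by auto
  have sgn: "of_int (sign p) * of_int (sign p) = (1 :: real)"
    by (simp add: sign_def)
  have "(\<Prod>i<n. w i) / fact n * vand n A * vand n (\<lambda>i. y (p i)) \<le> detn n (\<lambda>i j. M i (p j))"
    using pn y S by (intro detn_series_ge[OF w A p(2)]) auto
  then have "(\<Prod>i<n. w i) / fact n * vand n A * vand n (\<lambda>i. y (p i)) * vand n (\<lambda>i. y (p i))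
      \<le> detn n (\<lambda>i j. M i (p j)) * vand n (\<lambda>i. y (p i))"
    using vand_pos[OF p(2)] by (intro mult_right_mono) auto
  also have "detn n (\<lambda>i j. M i (p j)) * vand n (\<lambda>i. y (p i)) =
      of_int (sign p) * of_int (sign p) * (detn n M * vand n y)"
    by (simp add: detn_permute_cols[OF p(1)] vand_permute[OF p(1)])
  also have "(\<Prod>i<n. w i) / fact n * vand n A * vand n (\<lambda>i. y (p i)) * vand n (\<lambda>i. y (p i)) =
      of_int (sign p) * of_int (sign p) * ((\<Prod>i<n. w i) / fact n * vand n A * (vand n y)\<^sup>2)"
    by (simp add: vand_permute[OF p(1)] power2_eq_square)
  finally show ?thesis by (simp add: sgn)
qed (simp add: vand_eq_0)

section \<open>Divided differences of entire kernels\<close>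

definition pseries :: "(nat \<Rightarrow> real) \<Rightarrow> real \<Rightarrow> real" where
  "pseries w z = (\<Sum>p. w p * z ^ p)"

text \<open>The divided difference of \<open>\<lambda>a. pseries w (a * y)\<close> at the nodes \<open>A 0, \<dots>, A i\<close>; it makes sense for
  coinciding nodes, too.\<close>

definition dd :: "(nat \<Rightarrow> real) \<Rightarrow> (nat \<Rightarrow> real) \<Rightarrow> nat \<Rightarrow> real \<Rightarrow> real" where
  "dd w A i y = (\<Sum>p. w p * newton A p i * y ^ p)"

lemma measurable_dd [measurable]: "dd w A i \<in> borel_measurable borel"
  unfolding dd_def[abs_def] by measurable

lemma ex_common_bound: "\<exists>M. \<forall>j\<le>i. \<bar>A j\<bar> \<le> (M :: real)" for i :: nat
  by (intro exI[of _ "\<Sum>j\<le>i. \<bar>A j\<bar>"]) (auto intro: member_le_sum)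

locale pos_entire =
  fixes w :: "nat \<Rightarrow> real"
  assumes w_pos: "0 < w p"
    and summable: "summable (\<lambda>p. w p * z ^ p)"
begin

lemma dd_term_le:
  assumes "\<And>j. j \<le> i \<Longrightarrow> \<bar>A j\<bar> \<le> M"
  shows "norm (w p * newton A p i * y ^ p) \<le> w p * ((1 + M) * \<bar>y\<bar>) ^ p"
proof -
  have "norm (w p * newton A p i * y ^ p) = w p * (\<bar>newton A p i\<bar> * \<bar>y\<bar> ^ p)"
    using w_pos[of p] by (simp add: abs_mult power_abs)
  also have "\<dots> \<le> w p * ((1 + M) ^ p * \<bar>y\<bar> ^ p)"
    using w_pos[of p] by (intro mult_left_mono mult_right_mono abs_newton_le assms) auto
  finally show ?thesis by (simp add: power_mult_distrib)
qed

lemma summable_dd: "summable (\<lambda>p. w p * newton A p i * y ^ p)"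
proof -
  obtain M where "\<And>j. j \<le> i \<Longrightarrow> \<bar>A j\<bar> \<le> M" using ex_common_bound by blast
  from dd_term_le[of i A M _ y, OF this] show ?thesis
    by (intro summable_comparison_test[OF _ summable]) blast
qed

lemma abs_dd_le:
  assumes "\<And>j. j \<le> i \<Longrightarrow> \<bar>A j\<bar> \<le> M"
  shows "\<bar>dd w A i y\<bar> \<le> pseries w ((1 + M) * \<bar>y\<bar>)"
proof -
  note le = dd_term_le[of i A M _ y, OF assms]
  have s: "summable (\<lambda>p. norm (w p * newton A p i * y ^ p))"
    by (rule summable_comparison_test[OF _ summable]) (use le in auto)
  have "\<bar>dd w A i y\<bar> \<le> (\<Sum>p. norm (w p * newton A p i * y ^ p))"
    unfolding dd_def using summable_norm[OF s] by simp
  also have "\<dots> \<le> pseries w ((1 + M) * \<bar>y\<bar>)"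
    unfolding pseries_def using le by (intro suminf_le s summable) auto
  finally show ?thesis .
qed

text \<open>Dominated convergence for series: a bound for the limit nodes, enlarged by 1, eventually
  bounds the nodes along the sequence and gives a common majorant.\<close>

lemma tendsto_dd:
  fixes X :: "nat \<Rightarrow> nat \<Rightarrow> real"
  assumes "\<And>j. j \<le> i \<Longrightarrow> (\<lambda>s. X s j) \<longlonglongrightarrow> A j"
  shows "(\<lambda>s. dd w (X s) i y) \<longlonglongrightarrow> dd w A i y"
proof -
  obtain M where "\<And>j. j \<le> i \<Longrightarrow> \<bar>A j\<bar> \<le> M" using ex_common_bound by blast
  then have M: "\<bar>A j\<bar> < M + 1" if "j \<le> i" for j using that by fastforce
  define K where "K = M + 1"
  have "\<forall>\<^sub>F s in sequentially. \<bar>X s j\<bar> \<le> K" if "j \<le> i" for j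
    using order_tendstoD(2)[OF tendsto_rabs[OF assms[OF that]] M[OF that]]
    by (auto simp: K_def elim: eventually_mono)
  then have "\<forall>\<^sub>F s in sequentially. \<forall>j\<in>{..i}. \<bar>X s j\<bar> \<le> K"
    by (intro eventually_ball_finite) auto
  moreover have le: "norm (w p * newton (X s) p i * y ^ p) \<le> w p * ((1 + K) * \<bar>y\<bar>) ^ p"
    if "\<forall>j\<in>{..i}. \<bar>X s j\<bar> \<le> K" for p s
    using that by (intro dd_term_le) auto
  ultimately have "\<forall>\<^sub>F (p, s) in at_top \<times>\<^sub>F sequentially.
      norm (w p * newton (X s) p i * y ^ p) \<le> w p * ((1 + K) * \<bar>y\<bar>) ^ p"
    unfolding eventually_prod_filter
    by (intro exI[of _ "\<lambda>_. True"] exI[of _ "\<lambda>s. \<forall>j\<in>{..i}. \<bar>X s j\<bar> \<le> K"])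
       (auto simp del: real_norm_def intro: le)
  then show ?thesis
    unfolding dd_def
    by (intro tannerys_theorem[THEN conjunct2, THEN conjunct2, OF _ _ summable]
        tendsto_intros tendsto_newton assms) auto
qed

lemma pseries_newton:
  assumes "i < n"
  shows "pseries w (A i * y) = (\<Sum>k<n. (\<Prod>l<k. A i - A l) * dd w A k y)"
proof -
  have "w p * (A i * y) ^ p = (\<Sum>k<n. (\<Prod>l<k. A i - A l) * (w p * newton A p k * y ^ p))" for p
    unfolding power_mult_distrib newton_expansion[OF assms, of A p]
    by (simp add: sum_distrib_left sum_distrib_right mult_ac)
  then show ?thesis
    unfolding pseries_def dd_def
    by (simp add: suminf_sum suminf_mult summable_mult summable_dd)
qed

lemma detn_pseries: "detn n (\<lambda>i j. pseries w (A i * y j)) = vand n A * detn n (\<lambda>i j. dd w A i (y j))"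
  by (intro detn_newton_factor pseries_newton)

text \<open>The positive factor \<open>vand n A\<close> cancels. What is left is a lower bound
  independent of \<open>A\<close>, which therefore survives the merging of the nodes.\<close>

lemma detn_dd_vand_ge:
  assumes A: "strict_mono_on {..<n} A" "\<And>i. i < n \<Longrightarrow> 0 < A i"
    and y: "\<And>i. i < n \<Longrightarrow> 0 < y i"
  shows "(\<Prod>i<n. w i) / fact n * (vand n y)\<^sup>2 \<le> detn n (\<lambda>i j. dd w A i (y j)) * vand n y"
proof -
  have "(\<Prod>i<n. w i) / fact n * vand n A * (vand n y)\<^sup>2
      \<le> detn n (\<lambda>i j. pseries w (A i * y j)) * vand n y"
    unfolding pseries_def using w_pos
    by (intro detn_series_vand_ge[OF _ A y] summable_sums summable) (auto intro: less_imp_le)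
  then have "vand n A * ((\<Prod>i<n. w i) / fact n * (vand n y)\<^sup>2)
      \<le> vand n A * (detn n (\<lambda>i j. dd w A i (y j)) * vand n y)"
    by (simp add: detn_pseries mult_ac)
  then show ?thesis
    by (rule mult_left_le_imp_le[OF _ vand_pos[OF A(1)]])
qed

lemma detn_dd_const_vand_ge:
  assumes a: "0 \<le> a" and y: "\<And>i. i < n \<Longrightarrow> 0 < y i"
  shows "(\<Prod>i<n. w i) / fact n * (vand n y)\<^sup>2 \<le> detn n (\<lambda>i j. dd w (\<lambda>_. a) i (y j)) * vand n y"
proof (rule LIMSEQ_le_const)
  \<comment> \<open>Increasing nodes that merge at \<open>a\<close>; the numerator
    \<open>Suc j\<close> keeps all of them positive even for \<open>a = 0\<close>.\<close>
  define X where "X s j = a + real (Suc j) * (1 / real (Suc s))" for s j :: nat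
  have "(\<lambda>s. X s j) \<longlonglongrightarrow> a + real (Suc j) * 0" for j
    unfolding X_def by (intro tendsto_intros LIMSEQ_Suc[OF lim_1_over_n])
  then show "(\<lambda>s. detn n (\<lambda>i j. dd w (X s) i (y j)) * vand n y)
      \<longlonglongrightarrow> detn n (\<lambda>i j. dd w (\<lambda>_. a) i (y j)) * vand n y"
    by (intro tendsto_intros tendsto_detn tendsto_dd) simp
  have "(\<Prod>i<n. w i) / fact n * (vand n y)\<^sup>2 \<le> detn n (\<lambda>i j. dd w (X s) i (y j)) * vand n y" for s
  proof (rule detn_dd_vand_ge[OF _ _ y])
    show "strict_mono_on {..<n} (X s)"
      by (auto simp: strict_mono_on_def X_def divide_strict_right_mono)
    show "0 < X s i" for i
      using a by (simp add: X_def add_nonneg_pos)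
  qed
  then show "\<exists>N. \<forall>s\<ge>N. (\<Prod>i<n. w i) / fact n * (vand n y)\<^sup>2
      \<le> detn n (\<lambda>i j. dd w (X s) i (y j)) * vand n y" by blast
qed

lemma detn_kernel:
  "detn n (\<lambda>i k. r i * h k * pseries w (A i * y k)) =
    (\<Prod>i<n. r i) * vand n A * detn n (\<lambda>i k. h k * dd w A i (y k))"
  using detn_scale[of n r h "\<lambda>i k. pseries w (A i * y k)"]
    detn_scale[of n "\<lambda>_. 1" h "\<lambda>i k. dd w A i (y k)"]
  by (simp add: detn_pseries)

end

text \<open>With all nodes at the origin the divided difference is a Maclaurin coefficient. This is
  what makes the confluent end functions monomials times a common factor.\<close>

lemma dd_zero: "dd w (\<lambda>_. 0) i y = w i * y ^ i"
proof -
  have "w p * newton (\<lambda>_. 0) p i * y ^ p = (if p = i then w p * y ^ p else 0)" for p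
    by (cases "p < i") (auto simp: newton_const binomial_eq_0)
  then show ?thesis
    unfolding dd_def using sums_unique[OF sums_single[of i "\<lambda>p. w p * y ^ p"]] by (simp only:)
qed

lemma detn_dd_zero:
  "detn n (\<lambda>i k. h k * dd w (\<lambda>_. 0) i (\<eta> * y k)) =
    (\<Prod>i<n. w i * \<eta> ^ i) * detn n (\<lambda>i k. y k ^ i * h k)"
  using detn_scale[of n "\<lambda>i. w i * \<eta> ^ i" "\<lambda>_. 1" "\<lambda>i k. y k ^ i * h k"]
  by (simp add: dd_zero power_mult_distrib mult_ac)

lemma detn_power_cols: "detn n (\<lambda>i k. y k ^ i * h k) = (\<Prod>k<n. h k) * vand n y"
  using detn_scale[of n "\<lambda>_. 1" h "\<lambda>i k. y k ^ i"] detn_transpose[of n "\<lambda>i k. y i ^ k"]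
  by (simp add: detn_vandermonde mult_ac)

lemma vand_scale: "vand n (\<lambda>k. \<eta> * y k) = (\<Prod>k<n. \<eta> ^ k) * vand n y"
  using detn_scale[of n "\<lambda>_. 1" "\<lambda>k. \<eta> ^ k" "\<lambda>i k. y i ^ k"]
  by (simp add: detn_vandermonde[symmetric] power_mult_distrib)

section \<open>The squared Bessel kernel\<close>

text \<open>The coefficients of the entire function that equals
  \<open>z powr (- \<nu> / 2) * besselI \<nu> (2 * sqrt z)\<close> for positive \<open>z\<close>:
  the Bessel function freed of its root and its real power.\<close>

definition bphi :: "real \<Rightarrow> nat \<Rightarrow> real" where
  "bphi \<nu> p = 1 / (fact p * Gamma (real p + \<nu> + 1))"

text \<open>The ratio of consecutive \<open>u p\<close> tends to 0 for every
  \<open>\<delta>\<close>. The freedom to take \<open>\<delta>\<close> small later makes exponential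
  growth rates arbitrarily small.\<close>

lemma rGamma_le_geometric:
  assumes \<nu>: "-1 < \<nu>" and \<delta>: "0 < \<delta>"
  shows "\<exists>C\<ge>0. \<forall>p. 1 / Gamma (real p + \<nu> + 1) \<le> C * \<delta> ^ p"
proof -
  define u where "u p = (1 / \<delta>) ^ p / Gamma (real p + \<nu> + 1)" for p
  have upos: "0 < u p" for p
    unfolding u_def using \<nu> \<delta> by (intro divide_pos_pos Gamma_real_pos) auto
  have step: "u (Suc p) = u p / (\<delta> * (real p + \<nu> + 1))" for p
    using \<nu> Gamma_plus1[of "real p + \<nu> + 1"]
    by (simp add: u_def algebra_simps nonpos_Ints_def)
  have "summable u"
  \<comment> \<open>From this index on \<open>\<delta> * (real p + \<nu> + 1)\<close> is at least 2,
    so the ratio is at most one half.\<close>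
  proof (rule summable_ratio_test[of "1 / 2" "nat \<lceil>2 / \<delta>\<rceil>"])
    fix p assume "nat \<lceil>2 / \<delta>\<rceil> \<le> p"
    then have "2 / \<delta> \<le> real p" by linarith
    then have "2 \<le> \<delta> * real p" using \<delta> by (simp add: field_simps)
    also have "\<dots> \<le> \<delta> * (real p + \<nu> + 1)" using \<nu> \<delta> by (intro mult_left_mono) auto
    finally have "u p / (\<delta> * (real p + \<nu> + 1)) \<le> u p / 2"
      using upos[of p] \<delta> \<nu> by (intro divide_left_mono mult_pos_pos) auto
    moreover have "norm (u (Suc p)) = u p / (\<delta> * (real p + \<nu> + 1))"
      using upos[of "Suc p"] by (simp only: step[symmetric] real_norm_def abs_of_pos)
    ultimately show "norm (u (Suc p)) \<le> 1 / 2 * norm (u p)"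
      using upos[of p] by simp
  qed simp
  then have "Bseq u"
    by (rule convergent_imp_Bseq[OF convergentI[OF summable_LIMSEQ_zero]])
  then obtain C where C: "0 < C" "\<And>p. norm (u p) \<le> C" by (auto elim: BseqE)
  have "1 / Gamma (real p + \<nu> + 1) \<le> C * \<delta> ^ p" for p
  proof -
    have "1 / Gamma (real p + \<nu> + 1) = u p * \<delta> ^ p"
      using \<delta> by (simp add: u_def power_divide)
    also have "\<dots> \<le> C * \<delta> ^ p"
      using C(2)[of p] upos[of p] \<delta> by (intro mult_right_mono) auto
    finally show ?thesis .
  qed
  then show ?thesis using C(1) by (intro exI[of _ C]) auto
qed

lemma bphi_pos: "-1 < \<nu> \<Longrightarrow> 0 < bphi \<nu> p"
  unfolding bphi_def by (intro divide_pos_pos mult_pos_pos Gamma_real_pos) auto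

lemma bphi_term_le:
  assumes "\<And>p. 1 / Gamma (real p + \<nu> + 1) \<le> C * \<delta> ^ p" "0 \<le> z"
  shows "bphi \<nu> p * z ^ p \<le> C * ((\<delta> * z) ^ p /\<^sub>R fact p)"
proof -
  have "1 / Gamma (real p + \<nu> + 1) * (z ^ p / fact p) \<le> C * \<delta> ^ p * (z ^ p / fact p)"
    using assms by (intro mult_right_mono) auto
  then show ?thesis by (simp add: bphi_def power_mult_distrib field_simps)
qed

lemma pos_entire_bphi:
  assumes "-1 < \<nu>"
  shows "pos_entire (bphi \<nu>)"
proof
  show "0 < bphi \<nu> p" for p using assms by (rule bphi_pos)
  fix z :: real
  obtain C where C: "\<And>p. 1 / Gamma (real p + \<nu> + 1) \<le> C * 1 ^ p"
    using rGamma_le_geometric[OF assms, of 1] by auto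
  have "norm (bphi \<nu> p * z ^ p) \<le> C * ((1 * \<bar>z\<bar>) ^ p /\<^sub>R fact p)" for p
    using bphi_term_le[OF C, of "\<bar>z\<bar>" p] bphi_pos[OF assms, of p] by (simp add: abs_mult power_abs)
  then show "summable (\<lambda>p. bphi \<nu> p * z ^ p)"
    by (intro summable_comparison_test[OF _ summable_mult[OF summable_exp_generic]]) blast
qed

text \<open>The factorial in \<open>bphi\<close> sums to an exponential whose rate the Gamma factor
  scales down by \<open>\<delta>\<close>: the kernel grows slower than every exponential.\<close>

lemma pseries_bphi_le_exp:
  assumes "-1 < \<nu>" "0 \<le> K" "0 < \<eta>"
  shows "\<exists>C\<ge>0. \<forall>x\<ge>0. pseries (bphi \<nu>) (K * x) \<le> C * exp (\<eta> * x)"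
proof -
  interpret pos_entire "bphi \<nu>" using assms(1) by (rule pos_entire_bphi)
  \<comment> \<open>The summand 1 covers the case \<open>K = 0\<close>.\<close>
  define \<delta> where "\<delta> = \<eta> / (K + 1)"
  have \<delta>: "0 < \<delta>" "\<delta> * K \<le> \<eta>" using assms by (simp_all add: \<delta>_def field_simps)
  obtain C where C: "0 \<le> C" "\<And>p. 1 / Gamma (real p + \<nu> + 1) \<le> C * \<delta> ^ p"
    using rGamma_le_geometric[OF assms(1) \<delta>(1)] by auto
  have "pseries (bphi \<nu>) (K * x) \<le> C * exp (\<eta> * x)" if "0 \<le> x" for x
  proof -
    have "pseries (bphi \<nu>) (K * x) \<le> (\<Sum>p. C * ((\<delta> * (K * x)) ^ p /\<^sub>R fact p))"
      unfolding pseries_def using assms(2) that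
      by (intro suminf_le summable bphi_term_le[OF C(2)] summable_mult summable_exp_generic) auto
    also have "\<dots> = C * exp (\<delta> * K * x)"
      by (subst suminf_mult[OF summable_exp_generic]) (simp add: exp_def mult.assoc)
    also have "\<dots> \<le> C * exp (\<eta> * x)"
      using C(1) \<delta>(2) that by (intro mult_left_mono) (auto intro: mult_right_mono)
    finally show ?thesis .
  qed
  then show ?thesis using C(1) by blast
qed

text \<open>The power of \<open>x\<close> in the prefactor cancels against the one split off from
  the Bessel function. Apart from the series in \<open>x * y\<close>, the density is thus a function
  of \<open>x\<close> times a function of \<open>y\<close>, and such factors leave a
  determinant.\<close>

lemma besq_density_eq:
  assumes \<nu>: "-1 < \<nu>" and "0 < t" "0 < x" "0 < y" and c: "c = 1 / (2 * t)"
  shows "besq_density \<nu> t x y =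
    c powr (\<nu> + 1) * y powr \<nu> * exp (- c * x) * exp (- c * y) * pseries (bphi \<nu>) (c\<^sup>2 * x * y)"
proof -
  interpret pos_entire "bphi \<nu>" using \<nu> by (rule pos_entire_bphi)
  define z where "z = c * sqrt (x * y)"
  have cp: "0 < c" using assms by simp
  have z: "0 < z" "z\<^sup>2 = c\<^sup>2 * x * y"
    using assms(3,4) cp by (simp_all add: z_def power_mult_distrib)
  have z2: "sqrt (x * y) / t / 2 = z"
    by (simp add: z_def c)
  have "z powr (2 * real k + \<nu>) = z powr \<nu> * (c\<^sup>2 * x * y) ^ k" for k
  proof -
    have "z powr (2 * real k + \<nu>) = z powr \<nu> * z powr real (2 * k)"
      by (simp add: powr_add mult.commute)
    then show ?thesis
      using z(1,2) powr_realpow[OF z(1), of "2 * k"] by (simp add: power_mult)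
  qed
  then have "besselI \<nu> (sqrt (x * y) / t) = (\<Sum>k. z powr \<nu> * (bphi \<nu> k * (c\<^sup>2 * x * y) ^ k))"
    unfolding besselI_def z2 by (simp add: bphi_def)
  also have "\<dots> = z powr \<nu> * pseries (bphi \<nu>) (c\<^sup>2 * x * y)"
    unfolding pseries_def by (intro suminf_mult summable)
  finally have I: "besselI \<nu> (sqrt (x * y) / t) = z powr \<nu> * pseries (bphi \<nu>) (c\<^sup>2 * x * y)" .
  have "(y / x) powr (\<nu> / 2) * z powr \<nu> = exp (\<nu> / 2 * (ln y - ln x) + \<nu> * (ln c + (ln x + ln y) / 2))"
    using assms cp z(1) by (simp add: powr_def z_def exp_add ln_div ln_mult ln_sqrt)
  also have "\<dots> = exp (\<nu> * ln c + \<nu> * ln y)"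
    by (simp add: field_simps)
  also have "\<dots> = c powr \<nu> * y powr \<nu>"
    using assms cp by (simp add: powr_def exp_add)
  finally have P: "(y / x) powr (\<nu> / 2) * z powr \<nu> = c powr \<nu> * y powr \<nu>" .
  have E: "- (x + y) / (2 * t) = - c * x + - c * y"
    using assms(2) by (simp add: c field_simps)
  have "besq_density \<nu> t x y =
      c * ((y / x) powr (\<nu> / 2) * z powr \<nu>) * exp (- c * x + - c * y) * pseries (bphi \<nu>) (c\<^sup>2 * x * y)"
    unfolding besq_density_def I E c[symmetric] by (simp add: mult_ac)
  also have "\<dots> = c powr (\<nu> + 1) * y powr \<nu> * exp (- c * x) * exp (- c * y) * pseries (bphi \<nu>) (c\<^sup>2 * x * y)"
    unfolding P exp_add using cp by (simp add: powr_add)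
  finally show ?thesis .
qed

text \<open>After the shift by \<open>i\<close> the binomial coefficient cancels the factorial in
  \<open>bphi\<close>, and the argument of Gamma has grown by \<open>i\<close>. Each further
  derivative of the kernel thus raises the Bessel order by one.\<close>

lemma dd_bphi_const:
  assumes "-1 < \<nu>"
  shows "dd (bphi \<nu>) (\<lambda>_. a) i y = y ^ i / fact i * pseries (bphi (\<nu> + real i)) (a * y)"
proof -
  interpret pos_entire "bphi \<nu>" using assms by (rule pos_entire_bphi)
  interpret i: pos_entire "bphi (\<nu> + real i)" using assms by (intro pos_entire_bphi) simp
  let ?f = "\<lambda>p. bphi \<nu> p * newton (\<lambda>_. a) p i * y ^ p"
  have "dd (bphi \<nu>) (\<lambda>_. a) i y = (\<Sum>p. ?f (p + i)) + (\<Sum>p<i. ?f p)"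
    unfolding dd_def by (rule suminf_split_initial_segment[OF summable_dd])
  also have "(\<Sum>p<i. ?f p) = 0"
    by (intro sum.neutral) (auto simp: newton_eq_0)
  also have "?f (p + i) = y ^ i / fact i * (bphi (\<nu> + real i) p * (a * y) ^ p)" for p
  proof -
    have "real (p + i choose i) = fact (p + i) / (fact i * fact p)"
      using binomial_fact[of i "p + i"] by simp
    then show ?thesis
      by (simp add: newton_const bphi_def power_add power_mult_distrib ac_simps)
  qed
  then have "(\<Sum>p. ?f (p + i)) = y ^ i / fact i * pseries (bphi (\<nu> + real i)) (a * y)"
    unfolding pseries_def by (simp only: suminf_mult[OF i.summable])
  finally show ?thesis by simp
qed

section \<open>Recurrence in the Bessel order\<close>

text \<open>Bessel's relation \<open>I_(\<mu> - 1) - I_(\<mu> + 1) = (2 \<mu> / z) I_\<mu>\<close>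
  with \<open>\<mu> = \<nu> + 1\<close>. The functional equation of Gamma gives it coefficient by
  coefficient; the constant one is separate because the summand with the factor \<open>z\<close>
  starts at degree 1.\<close>

lemma pseries_bphi_recurrence:
  assumes "-1 < \<nu>"
  shows "pseries (bphi \<nu>) z = z * pseries (bphi (\<nu> + 2)) z + (\<nu> + 1) * pseries (bphi (\<nu> + 1)) z"
proof -
  interpret e0: pos_entire "bphi \<nu>" using assms by (intro pos_entire_bphi) simp
  interpret e1: pos_entire "bphi (\<nu> + 1)" using assms by (intro pos_entire_bphi) simp
  interpret e2: pos_entire "bphi (\<nu> + 2)" using assms by (intro pos_entire_bphi) simp
  have G: "Gamma (real p + \<nu> + 2) = (real p + \<nu> + 1) * Gamma (real p + \<nu> + 1)" for p
    using assms Gamma_plus1[of "real p + \<nu> + 1"] by (simp add: nonpos_Ints_def add_ac)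
  have Gpos: "0 < Gamma (real p + \<nu> + 1)" for p
    using assms by (intro Gamma_real_pos) simp
  have b0: "bphi \<nu> 0 = (\<nu> + 1) * bphi (\<nu> + 1) 0"
    using assms G[of 0] Gpos[of 0] by (simp add: bphi_def add_ac)
  have bS: "bphi \<nu> (Suc p) = bphi (\<nu> + 2) p + (\<nu> + 1) * bphi (\<nu> + 1) (Suc p)" for p
  proof -
    have "real p + \<nu> + 2 > 0" using assms by simp
    then show ?thesis
      using G[of "Suc p"] Gpos[of "Suc p"] assms
      by (simp add: bphi_def add_ac divide_simps)
  qed
  have "pseries (bphi (\<nu> + 1)) z = bphi (\<nu> + 1) 0 + (\<Sum>p. bphi (\<nu> + 1) (Suc p) * z ^ Suc p)"
    unfolding pseries_def using suminf_split_head[OF e1.summable[of z]] by simp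
  moreover have "pseries (bphi \<nu>) z = bphi \<nu> 0 + (\<Sum>p. bphi \<nu> (Suc p) * z ^ Suc p)"
    unfolding pseries_def using suminf_split_head[OF e0.summable[of z]] by simp
  moreover have "(\<Sum>p. bphi \<nu> (Suc p) * z ^ Suc p) =
      (\<Sum>p. z * (bphi (\<nu> + 2) p * z ^ p) + (\<nu> + 1) * (bphi (\<nu> + 1) (Suc p) * z ^ Suc p))"
    by (simp add: bS algebra_simps)
  moreover have "\<dots> = z * pseries (bphi (\<nu> + 2)) z +
      (\<nu> + 1) * (\<Sum>p. bphi (\<nu> + 1) (Suc p) * z ^ Suc p)"
    using e2.summable[of z] e1.summable[of z, THEN summable_Suc_iff[THEN iffD2]]
    by (simp only: suminf_add[symmetric] suminf_mult summable_mult pseries_def)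
  ultimately show ?thesis by (simp add: b0 algebra_simps)
qed

text \<open>Relative to the common factor \<open>X\<close>, order \<open>\<nu> + 2\<close> carries
  \<open>c\<^sup>2 * x\<^sup>2\<close>, which is \<open>x / a\<close> times the argument
  \<open>Z\<close> of the series; this produces the factor \<open>x / a\<close>.\<close>

lemma besq_density_recurrence:
  assumes "-1 < \<nu>" "0 < t" "0 < a" "0 < x"
  shows "besq_density (\<nu> + 2) t a x =
    x / a * besq_density \<nu> t a x - (\<nu> + 1) * (2 * t) / a * besq_density (\<nu> + 1) t a x"
proof -
  define c where "c = 1 / (2 * t)"
  have c: "0 < c" "2 * t = 1 / c" using assms by (simp_all add: c_def)
  define X where "X = c powr (\<nu> + 1) * x powr \<nu> * exp (- c * a) * exp (- c * x)"
  define Z where "Z = c\<^sup>2 * a * x"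
  note eq = besq_density_eq[OF _ assms(2-4) c_def]
  have "besq_density (\<nu> + 2) t a x = X * c\<^sup>2 * x\<^sup>2 * pseries (bphi (\<nu> + 2)) Z"
    using assms c(1) by (subst eq) (auto simp: X_def Z_def powr_add powr_numeral power2_eq_square power3_eq_cube)
  moreover have "besq_density (\<nu> + 1) t a x = X * c * x * pseries (bphi (\<nu> + 1)) Z"
    using assms c(1) by (subst eq) (auto simp: X_def Z_def powr_add powr_numeral power2_eq_square)
  moreover have "besq_density \<nu> t a x = X * pseries (bphi \<nu>) Z"
    using assms by (subst eq) (auto simp: X_def Z_def)
  moreover have "x / a * (X * (Z * pseries (bphi (\<nu> + 2)) Z)) =
      X * c\<^sup>2 * x\<^sup>2 * pseries (bphi (\<nu> + 2)) Z"
    using assms by (simp add: Z_def power2_eq_square)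
  moreover have "x / a * (X * ((\<nu> + 1) * pseries (bphi (\<nu> + 1)) Z)) =
      (\<nu> + 1) * (2 * t) / a * (X * c * x * pseries (bphi (\<nu> + 1)) Z)"
    using assms c(1) by (simp add: c(2))
  ultimately show ?thesis
    using pseries_bphi_recurrence[OF assms(1), of Z] by (simp only: distrib_left)
qed

text \<open>Coefficients of the density of order \<open>\<alpha> + m\<close> with respect to
  \<open>x ^ (i div 2)\<close> times the density of order \<open>\<alpha> + i mod 2\<close>.\<close>

fun besq_coeff :: "real \<Rightarrow> (nat \<Rightarrow> real) \<Rightarrow> nat \<Rightarrow> nat \<Rightarrow> real" where
  "besq_coeff a \<beta> 0 i = (if i = 0 then 1 else 0)"
| "besq_coeff a \<beta> (Suc 0) i = (if i = 1 then 1 else 0)"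
| "besq_coeff a \<beta> (Suc (Suc m)) i =
    (if i < 2 then 0 else besq_coeff a \<beta> m (i - 2)) / a - \<beta> m * besq_coeff a \<beta> (Suc m) i"

lemma besq_coeff_eq_0: "m < i \<Longrightarrow> besq_coeff a \<beta> m i = 0"
  by (induction a \<beta> m i rule: besq_coeff.induct) auto

lemma besq_coeff_diag: "a \<noteq> 0 \<Longrightarrow> besq_coeff a \<beta> m m \<noteq> 0"
proof (induction m rule: induct_nat_012)
  case (ge2 m)
  then show ?case by (simp add: besq_coeff_eq_0)
qed auto

text \<open>The recurrence connects \<open>q (Suc (Suc m))\<close> to \<open>q m\<close> by a factor
  \<open>x\<close>. Raising an index \<open>i\<close> by 2 keeps its parity and raises
  \<open>i div 2\<close> by one, so only \<open>q 0\<close> and \<open>q 1\<close> remain, with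
  polynomial coefficients.\<close>

lemma three_term_expansion:
  assumes rec: "\<And>m. q (Suc (Suc m)) = x / a * q m - \<beta> m * q (Suc m)"
  shows "m < N \<Longrightarrow> q m = (\<Sum>i<N. besq_coeff a \<beta> m i * (x ^ (i div 2) * q (i mod 2)))"
proof (induction m arbitrary: N rule: induct_nat_012)
  case 0
  then show ?case by (simp add: if_distrib[of "\<lambda>c. c * _"] cong: if_cong)
next
  case 1
  then show ?case by (simp add: if_distrib[of "\<lambda>c. c * _"] cong: if_cong)
next
  case (ge2 m)
  define F where "F i = x ^ (i div 2) * q (i mod 2)" for i
  obtain N' where N: "N = Suc (Suc N')" and mN': "m < N'"
    using ge2.prems by (metis Suc_less_eq2)
  have "(\<Sum>i<N. (if i < 2 then 0 else besq_coeff a \<beta> m (i - 2)) / a * F i) =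
      (\<Sum>i<N'. besq_coeff a \<beta> m i / a * F (Suc (Suc i)))"
    unfolding N sum.lessThan_Suc_shift by simp
  also have "\<dots> = x / a * (\<Sum>i<N'. besq_coeff a \<beta> m i * F i)"
    by (simp add: F_def sum_distrib_left mult_ac)
  also have "(\<Sum>i<N'. besq_coeff a \<beta> m i * F i) = q m"
    using ge2.IH(1)[OF mN'] by (simp add: F_def)
  finally have "x / a * q m = (\<Sum>i<N. (if i < 2 then 0 else besq_coeff a \<beta> m (i - 2)) / a * F i)" ..
  moreover have "q (Suc m) = (\<Sum>i<N. besq_coeff a \<beta> (Suc m) i * F i)"
    using ge2.IH(2)[of N] ge2.prems by (simp add: F_def)
  ultimately have "q (Suc (Suc m)) = (\<Sum>i<N. (if i < 2 then 0 else besq_coeff a \<beta> m (i - 2)) / a * F i)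
      - \<beta> m * (\<Sum>i<N. besq_coeff a \<beta> (Suc m) i * F i)"
    by (simp only: rec)
  also have "\<dots> = (\<Sum>i<N. besq_coeff a \<beta> (Suc (Suc m)) i * F i)"
    unfolding sum_distrib_left sum_subtractf[symmetric]
    by (rule sum.cong) (auto simp: algebra_simps)
  finally show ?case by (simp only: F_def)
qed

text \<open>\<open>D\<close> is the determinant of the expansion coefficients, a lower triangular
  matrix with nonzero diagonal that does not involve \<open>y\<close>.\<close>

lemma detn_besq_orders:
  assumes "-1 < \<alpha>" "0 < t" "0 < a"
  shows "\<exists>D. D \<noteq> 0 \<and> (\<forall>y. (\<forall>k<n. 0 < y k) \<longrightarrow>
    detn n (\<lambda>i k. besq_density (\<alpha> + real i) t a (y k)) =
    D * detn n (\<lambda>i k. y k ^ (i div 2) * besq_density (\<alpha> + real (i mod 2)) t a (y k)))"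
proof -
  define \<beta> where "\<beta> m = (\<alpha> + real m + 1) * (2 * t) / a" for m :: nat
  have "besq_density (\<alpha> + real i) t a x = (\<Sum>l<n. besq_coeff a \<beta> i l *
      (x ^ (l div 2) * besq_density (\<alpha> + real (l mod 2)) t a x))" if "0 < x" "i < n" for x i
  proof (rule three_term_expansion[OF _ that(2), of "\<lambda>i. besq_density (\<alpha> + real i) t a x"])
    show "besq_density (\<alpha> + real (Suc (Suc m))) t a x =
        x / a * besq_density (\<alpha> + real m) t a x - \<beta> m * besq_density (\<alpha> + real (Suc m)) t a x" for m
      using besq_density_recurrence[of "\<alpha> + real m" t a x] assms that(1) by (simp add: \<beta>_def add_ac)
  qed
  then have "detn n (\<lambda>i k. besq_density (\<alpha> + real i) t a (y k)) = detn n (besq_coeff a \<beta>) *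
      detn n (\<lambda>i k. y k ^ (i div 2) * besq_density (\<alpha> + real (i mod 2)) t a (y k))"
    if "\<forall>k<n. 0 < y k" for y
    using that unfolding detn_mult[symmetric] by (intro detn_cong) auto
  moreover have "detn n (besq_coeff a \<beta>) = (\<Prod>i<n. besq_coeff a \<beta> i i)"
    by (rule detn_lower_triangular) (rule besq_coeff_eq_0)
  then have "detn n (besq_coeff a \<beta>) \<noteq> 0"
    using besq_coeff_diag[of a \<beta>] assms(3) by simp
  ultimately show ?thesis by blast
qed

section \<open>Integration over the orthant\<close>

lemma pos_orthant_iff_space: "x \<in> space (lebesgue_n n) \<Longrightarrow> x \<in> pos_orthant n \<longleftrightarrow> (\<forall>j\<in>{1..n}. 0 < x j)"
  by (auto simp: space_PiM pos_orthant_def PiE_iff)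

lemma sets_pos_orthant [measurable]: "pos_orthant n \<in> sets (lebesgue_n n)"
  unfolding pos_orthant_def by (intro sets_PiM_I_finite) auto

lemma pos_orthant_pos: "x \<in> pos_orthant n \<Longrightarrow> k < n \<Longrightarrow> 0 < x (Suc k)"
  by (auto simp: pos_orthant_def PiE_iff)

lemma measurable_detn_cols:
  assumes "\<And>i. i < n \<Longrightarrow> F i \<in> borel_measurable borel"
  shows "(\<lambda>x. detn n (\<lambda>i k. F i (x (Suc k)))) \<in> borel_measurable (lebesgue_n n)"
proof -
  have "(\<lambda>x. F i (x (Suc k))) \<in> borel_measurable (lebesgue_n n)" if "i < n" "k < n" for i k
    using that by (intro measurable_compose[OF _ assms]) auto
  then show ?thesis
    unfolding detn_leibniz
    by (intro borel_measurable_sum borel_measurable_times borel_measurable_const borel_measurable_prod)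
       (auto simp: permutes_lessThan)
qed

text \<open>Each determinant is at most \<open>fact n\<close> times a product over the columns, so
  one product of integrable one-variable functions, \<open>W\<close> below, dominates the whole
  sequence.\<close>

lemma integral_orthant_dominated:
  fixes F H :: "nat \<Rightarrow> nat \<Rightarrow> real \<Rightarrow> real"
  assumes meas: "\<And>s i. F s i \<in> borel_measurable borel" "\<And>s i. H s i \<in> borel_measurable borel"
      "\<And>i. F0 i \<in> borel_measurable borel" "\<And>i. H0 i \<in> borel_measurable borel"
    and lim: "\<And>i x. i < n \<Longrightarrow> 0 < x \<Longrightarrow> (\<lambda>s. F s i x) \<longlonglongrightarrow> F0 i x"
      "\<And>i x. i < n \<Longrightarrow> 0 < x \<Longrightarrow> (\<lambda>s. H s i x) \<longlonglongrightarrow> H0 i x"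
    and bound: "\<And>s i x. i < n \<Longrightarrow> 0 < x \<Longrightarrow> \<bar>F s i x\<bar> \<le> \<beta> x"
      "\<And>s i x. i < n \<Longrightarrow> 0 < x \<Longrightarrow> \<bar>H s i x\<bar> \<le> \<gamma> x"
    and int: "set_integrable lborel {0<..} (\<lambda>x. \<beta> x * \<gamma> x)"
  defines "G \<equiv> \<lambda>s x. detn n (\<lambda>i k. F s i (x (Suc k))) * detn n (\<lambda>i k. H s i (x (Suc k)))"
    and "G0 \<equiv> \<lambda>x. detn n (\<lambda>i k. F0 i (x (Suc k))) * detn n (\<lambda>i k. H0 i (x (Suc k)))"
  shows "set_integrable (lebesgue_n n) (pos_orthant n) G0"
    and "(\<lambda>s. LINT x:pos_orthant n|lebesgue_n n. G s x) \<longlonglongrightarrow> (LINT x:pos_orthant n|lebesgue_n n. G0 x)"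
    and "\<And>x. x \<in> pos_orthant n \<Longrightarrow> (\<lambda>s. G s x) \<longlonglongrightarrow> G0 x"
proof -
  interpret product_sigma_finite "\<lambda>_ :: nat. lborel :: real measure" by standard
  show lim_G: "(\<lambda>s. G s x) \<longlonglongrightarrow> G0 x" if "x \<in> pos_orthant n" for x
    unfolding G_def G0_def
    by (intro tendsto_mult tendsto_detn lim pos_orthant_pos[OF that])
  have meas_G [measurable]: "G s \<in> borel_measurable (lebesgue_n n)" for s
    unfolding G_def by (intro borel_measurable_times measurable_detn_cols meas)
  have meas_G0 [measurable]: "G0 \<in> borel_measurable (lebesgue_n n)"
    unfolding G0_def by (intro borel_measurable_times measurable_detn_cols meas)
  define W where "W x = (fact n)\<^sup>2 * (\<Prod>j\<in>{1..n}. indicator {0<..} (x j) *\<^sub>R (\<beta> (x j) * \<gamma> (x j)))"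
    for x :: "nat \<Rightarrow> real"
  have W: "integrable (lebesgue_n n) W"
    unfolding W_def using int unfolding set_integrable_def
    by (intro integrable_mult_right product_integrable_prod) auto
  have le: "norm (indicator (pos_orthant n) x *\<^sub>R G s x) \<le> W x" if xs: "x \<in> space (lebesgue_n n)" for s x
  proof (cases "x \<in> pos_orthant n")
    case True
    note xp = pos_orthant_pos[OF True]
    have "\<bar>G s x\<bar> \<le> (fact n * (\<Prod>k<n. \<beta> (x (Suc k)))) * (fact n * (\<Prod>k<n. \<gamma> (x (Suc k))))"
      unfolding G_def abs_mult
      by (intro mult_mono abs_detn_le bound xp)
         (auto intro!: prod_nonneg mult_nonneg_nonneg order.trans[OF abs_ge_zero bound(1)] xp)
    also have "\<dots> = (fact n)\<^sup>2 * (\<Prod>k<n. \<beta> (x (Suc k)) * \<gamma> (x (Suc k)))"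
      by (simp add: prod.distrib power2_eq_square)
    also have "(\<Prod>k<n. \<beta> (x (Suc k)) * \<gamma> (x (Suc k))) = (\<Prod>j\<in>{1..n}. \<beta> (x j) * \<gamma> (x j))"
      by (rule prod.reindex_bij_witness[of _ "\<lambda>j. j - 1" Suc]) auto
    also have "\<dots> = (\<Prod>j\<in>{1..n}. indicator {0<..} (x j) *\<^sub>R (\<beta> (x j) * \<gamma> (x j)))"
      using True pos_orthant_iff_space[OF xs] by (intro prod.cong) auto
    finally show ?thesis using True by (simp add: W_def)
  next
    case False
    then obtain j where "j \<in> {1..n}" "\<not> 0 < x j" using pos_orthant_iff_space[OF xs] by blast
    then have "W x = 0" unfolding W_def by (auto intro!: bexI[of _ j])
    then show ?thesis using False by simp
  qed
  have "integrable (lebesgue_n n) (\<lambda>x. indicator (pos_orthant n) x *\<^sub>R G0 x) \<and>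
    (\<lambda>s. integral\<^sup>L (lebesgue_n n) (\<lambda>x. indicator (pos_orthant n) x *\<^sub>R G s x)) \<longlonglongrightarrow>
      integral\<^sup>L (lebesgue_n n) (\<lambda>x. indicator (pos_orthant n) x *\<^sub>R G0 x)"
  proof (intro conjI integrable_dominated_convergence[OF _ _ W] integral_dominated_convergence[OF _ _ W])
    have "(\<lambda>s. indicator (pos_orthant n) x *\<^sub>R G s x) \<longlonglongrightarrow> indicator (pos_orthant n) x *\<^sub>R G0 x" for x
      using lim_G[of x] by (cases "x \<in> pos_orthant n") auto
    then show "AE x in lebesgue_n n. (\<lambda>s. indicator (pos_orthant n) x *\<^sub>R G s x)
        \<longlonglongrightarrow> indicator (pos_orthant n) x *\<^sub>R G0 x"
      "AE x in lebesgue_n n. (\<lambda>s. indicator (pos_orthant n) x *\<^sub>R G s x)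
        \<longlonglongrightarrow> indicator (pos_orthant n) x *\<^sub>R G0 x" by auto
    show "AE x in lebesgue_n n. norm (indicator (pos_orthant n) x *\<^sub>R G s x) \<le> W x"
      "AE x in lebesgue_n n. norm (indicator (pos_orthant n) x *\<^sub>R G s x) \<le> W x" for s
      using le by (auto intro!: AE_I2)
  qed measurable
  then show "set_integrable (lebesgue_n n) (pos_orthant n) G0"
    "(\<lambda>s. LINT x:pos_orthant n|lebesgue_n n. G s x) \<longlonglongrightarrow> (LINT x:pos_orthant n|lebesgue_n n. G0 x)"
    by (auto simp: set_integrable_def set_lebesgue_integral_def)
qed

text \<open>Increasing configurations fill a set of positive measure, so \<open>G\<close> cannot
  vanish almost everywhere.\<close>

lemma integral_orthant_pos:
  fixes G :: "(nat \<Rightarrow> real) \<Rightarrow> real"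
  assumes int: "set_integrable (lebesgue_n n) (pos_orthant n) G"
    and nonneg: "\<And>x. x \<in> pos_orthant n \<Longrightarrow> 0 \<le> G x"
    and pos: "\<And>x. x \<in> pos_orthant n \<Longrightarrow> strict_mono_on {1..n} x \<Longrightarrow> 0 < G x"
  shows "0 < (LINT x:pos_orthant n|lebesgue_n n. G x)"
proof (rule ccontr)
  interpret product_sigma_finite "\<lambda>_ :: nat. lborel :: real measure" by standard
  let ?G = "\<lambda>x. indicator (pos_orthant n) x *\<^sub>R G x"
  assume "\<not> ?thesis"
  moreover have nn: "0 \<le> ?G x" for x
    using nonneg by (cases "x \<in> pos_orthant n") auto
  ultimately have "integral\<^sup>L (lebesgue_n n) ?G = 0"
    unfolding set_lebesgue_integral_def
    using Bochner_Integration.integral_nonneg[of "lebesgue_n n" ?G, OF nn] by linarith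
  then have AE: "AE x in lebesgue_n n. ?G x = 0"
    using int nn by (subst (asm) integral_nonneg_eq_0_iff_AE) (auto simp: set_integrable_def)
  \<comment> \<open>A box of volume 1 whose sides are disjoint intervals in increasing order, hence
    made of increasing configurations only.\<close>
  define B where "B = (\<Pi>\<^sub>E j\<in>{1..n}. {real j<..<real j + 1})"
  have B: "B \<in> sets (lebesgue_n n)"
    unfolding B_def by (intro sets_PiM_I_finite) auto
  have "?G x \<noteq> 0" if "x \<in> B" for x
  proof -
    have xj: "real j < x j" "x j < real j + 1" if "j \<in> {1..n}" for j
      using \<open>x \<in> B\<close> that by (auto simp: B_def PiE_iff)
    have "strict_mono_on {1..n} x"
    proof (rule strict_mono_onI)
      fix i j assume ij: "i \<in> {1..n}" "j \<in> {1..n}" "i < j"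
      then have "real i + 1 \<le> real j" by simp
      then show "x i < x j" using xj(2)[OF ij(1)] xj(1)[OF ij(2)] by linarith
    qed
    moreover have "x \<in> pos_orthant n"
      using that xj(1) by (fastforce simp: B_def pos_orthant_def PiE_iff)
    ultimately show ?thesis using pos by fastforce
  qed
  then have "AE x in lebesgue_n n. x \<notin> B"
    using AE by (auto elim: eventually_mono)
  then have "emeasure (lebesgue_n n) B = 0"
    using B AE_iff_measurable[of B "lebesgue_n n" "\<lambda>x. x \<notin> B"] sets.sets_into_space[OF B] by blast
  moreover have "emeasure (lebesgue_n n) B = 1"
    unfolding B_def by (subst emeasure_PiM) auto
  ultimately show False by simp
qed

text \<open>This is the modulus of Euler's complex Gamma integrand, which is absolutely integrable;
  measurability brings it from \<open>lebesgue\<close> to \<open>lborel\<close>.\<close>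

lemma set_integrable_powr_exp:
  fixes \<alpha> \<eta> :: real
  assumes "-1 < \<alpha>" "0 < \<eta>"
  shows "set_integrable lborel {0<..} (\<lambda>x. x powr \<alpha> * exp (- \<eta> * x))"
proof -
  let ?f = "\<lambda>t. complex_of_real t powr (complex_of_real (\<alpha> + 1) - 1) / of_real (exp (\<eta> * t))"
  have "set_integrable lebesgue {0<..} ?f"
    using assms by (intro absolutely_integrable_Gamma_integral) auto
  then have "integrable lebesgue (\<lambda>t. norm (indicator {0<..} t *\<^sub>R ?f t))"
    unfolding set_integrable_def by (rule integrable_norm)
  also have "(\<lambda>t. norm (indicator {0<..} t *\<^sub>R ?f t)) =
      (\<lambda>x. indicator {0<..} x *\<^sub>R (x powr \<alpha> * exp (- \<eta> * x)))"
    by (auto simp: fun_eq_iff indicator_def norm_divide norm_powr_real_powr exp_minus field_simps)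
  finally show ?thesis
    unfolding set_integrable_def by (subst (asm) integrable_completion) auto
qed

section \<open>The confluent limit\<close>

lemma strict_mono_on_shift:
  assumes "strict_mono_on {1..n} A"
  shows "strict_mono_on {..<n} (\<lambda>i. A (Suc i))"
  using assms by (auto simp: strict_mono_on_def)

text \<open>A convergent sequence of nodes is bounded over all \<open>s\<close>, so one constant
  serves every member, as a dominating function needs. Any rate \<open>\<eta>\<close> works because
  the kernel grows slower than every exponential.\<close>

lemma bounded_dd_bphi:
  fixes X :: "nat \<Rightarrow> nat \<Rightarrow> real"
  assumes \<nu>: "-1 < \<nu>" and \<kappa>: "0 \<le> \<kappa>" and \<eta>: "0 < \<eta>"
    and lim: "\<And>j. j < n \<Longrightarrow> convergent (\<lambda>s. X s j)"
  shows "\<exists>C\<ge>0. \<forall>s. \<forall>i<n. \<forall>x>0. \<bar>dd (bphi \<nu>) (X s) i (\<kappa> * x)\<bar> \<le> C * exp (\<eta> * x)"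
proof -
  interpret pos_entire "bphi \<nu>" using \<nu> by (rule pos_entire_bphi)
  have "\<forall>j\<in>{..<n}. \<exists>K\<ge>0. \<forall>s. \<bar>X s j\<bar> \<le> K"
  proof
    fix j assume "j \<in> {..<n}"
    then obtain K where "0 < K" "\<And>s. norm (X s j) \<le> K"
      using convergent_imp_Bseq[OF lim, of j] by (auto elim: BseqE)
    then show "\<exists>K\<ge>0. \<forall>s. \<bar>X s j\<bar> \<le> K" by (intro exI[of _ K]) auto
  qed
  from bchoice[OF this] obtain K where K: "\<And>j. j < n \<Longrightarrow> 0 \<le> K j" "\<And>j s. j < n \<Longrightarrow> \<bar>X s j\<bar> \<le> K j"
    by auto
  define M where "M = (\<Sum>j<n. K j)"
  have M0: "0 \<le> M" unfolding M_def using K(1) by (intro sum_nonneg) auto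
  have M: "\<bar>X s j\<bar> \<le> M" if "j < n" for s j
    using order.trans[OF K(2)[OF that] member_le_sum[of j "{..<n}" K]] K(1) that
    by (auto simp: M_def)
  obtain C where C: "0 \<le> C" "\<And>x. 0 \<le> x \<Longrightarrow> pseries (bphi \<nu>) ((1 + M) * \<kappa> * x) \<le> C * exp (\<eta> * x)"
    using pseries_bphi_le_exp[OF \<nu> _ \<eta>, of "(1 + M) * \<kappa>"] M0 \<kappa> by auto
  have "\<bar>dd (bphi \<nu>) (X s) i (\<kappa> * x)\<bar> \<le> C * exp (\<eta> * x)" if "i < n" "0 < x" for s i x
  proof -
    have "\<bar>dd (bphi \<nu>) (X s) i (\<kappa> * x)\<bar> \<le> pseries (bphi \<nu>) ((1 + M) * \<bar>\<kappa> * x\<bar>)"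
      using that(1) by (intro abs_dd_le M) auto
    also have "(1 + M) * \<bar>\<kappa> * x\<bar> = (1 + M) * \<kappa> * x"
      using that(2) \<kappa> by (simp add: abs_mult)
    also have "pseries (bphi \<nu>) \<dots> \<le> C * exp (\<eta> * x)"
      using that(2) by (intro C(2)) simp
    finally show ?thesis .
  qed
  then show ?thesis using C(1) by blast
qed

section \<open>Cancellation of the endpoint factors and passage to the limit\<close>

definition start_fun :: "real \<Rightarrow> real \<Rightarrow> (nat \<Rightarrow> real) \<Rightarrow> nat \<Rightarrow> real \<Rightarrow> real" where
  "start_fun \<alpha> c A i x = x powr \<alpha> * exp (- c * x) * dd (bphi \<alpha>) A i (c\<^sup>2 * x)"

text \<open>No power of \<open>x\<close> occurs here: in the factorized density the power sits on
  the second argument, which is now the endpoint.\<close>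

definition end_fun :: "real \<Rightarrow> real \<Rightarrow> (nat \<Rightarrow> real) \<Rightarrow> nat \<Rightarrow> real \<Rightarrow> real" where
  "end_fun \<alpha> d B i x = exp (- d * x) * dd (bphi \<alpha>) B i (d\<^sup>2 * x)"

text \<open>\<open>nonint_weight\<close> without the factors that depend on the endpoints only; unlike there, \<open>A\<close> and
  \<open>B\<close> are indexed from 0.\<close>

definition reduced_weight ::
    "real \<Rightarrow> real \<Rightarrow> real \<Rightarrow> nat \<Rightarrow> (nat \<Rightarrow> real) \<Rightarrow> (nat \<Rightarrow> real) \<Rightarrow> (nat \<Rightarrow> real) \<Rightarrow> real" where
  "reduced_weight \<alpha> c d n A B x =
    detn n (\<lambda>i k. start_fun \<alpha> c A i (x (Suc k))) * detn n (\<lambda>i k. end_fun \<alpha> d B i (x (Suc k)))"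

text \<open>\<open>K\<close> collects both Vandermonde factors of the endpoints and their
  one-variable prefactors. Being nonzero and independent of \<open>x\<close>, it cancels in the
  normalized density.\<close>

lemma nonint_weight_factor:
  assumes "-1 < \<alpha>" "0 < t" "t < T"
    and A: "A \<in> ordered_configs n" and B: "B \<in> ordered_configs n"
    and c: "c = 1 / (2 * t)" and d: "d = 1 / (2 * (T - t))"
  obtains K where "K \<noteq> 0" and "\<And>x. x \<in> pos_orthant n \<Longrightarrow>
    nonint_weight \<alpha> n T t A B x = K * reduced_weight \<alpha> c d n (\<lambda>j. A (Suc j)) (\<lambda>j. B (Suc j)) x"
proof -
  interpret pos_entire "bphi \<alpha>" using assms(1) by (rule pos_entire_bphi)
  define A' B' where "A' j = A (Suc j)" and "B' j = B (Suc j)" for j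
  have mono: "strict_mono_on {..<n} A'" "strict_mono_on {..<n} B'"
    unfolding A'_def[abs_def] B'_def[abs_def]
    using A B by (auto simp: ordered_configs_def intro!: strict_mono_on_shift)
  have pos: "0 < A' j" "0 < B' j" if "j < n" for j
    using A B that by (auto simp: ordered_configs_def A'_def B'_def)
  have cd: "0 < c" "0 < d" "0 < T - t" using assms by auto
  define r where "r i = c powr (\<alpha> + 1) * exp (- c * A' i)" for i
  define q where "q k = d powr (\<alpha> + 1) * B' k powr \<alpha> * exp (- d * B' k)" for k
  have detA: "det1 n (\<lambda>j k. besq_density \<alpha> t (A j) (x k)) = (\<Prod>i<n. r i) * vand n A' *
      detn n (\<lambda>i k. start_fun \<alpha> c A' i (x (Suc k)))"
    if x: "x \<in> pos_orthant n" for x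
  proof -
    have "det1 n (\<lambda>j k. besq_density \<alpha> t (A j) (x k)) = detn n (\<lambda>i k. r i *
        (x (Suc k) powr \<alpha> * exp (- c * x (Suc k))) * pseries (bphi \<alpha>) (A' i * (c\<^sup>2 * x (Suc k))))"
      unfolding det1_eq_detn using pos pos_orthant_pos[OF x] assms(1,2)
      by (intro detn_cong) (simp add: besq_density_eq[OF _ _ _ _ c] A'_def[symmetric] r_def mult_ac)
    then show ?thesis by (simp only: detn_kernel start_fun_def)
  qed
  have detB: "det1 n (\<lambda>j k. besq_density \<alpha> (T - t) (x j) (B k)) = (\<Prod>k<n. q k) * vand n B' *
      detn n (\<lambda>i k. end_fun \<alpha> d B' i (x (Suc k)))"
    if x: "x \<in> pos_orthant n" for x
  proof -
    \<comment> \<open>The endpoints index the columns here; transposition moves them to the rows,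
      where Newton interpolation acts.\<close>
    have "det1 n (\<lambda>j k. besq_density \<alpha> (T - t) (x j) (B k)) =
        detn n (\<lambda>k j. besq_density \<alpha> (T - t) (x (Suc j)) (B (Suc k)))"
      unfolding det1_eq_detn by (rule detn_transpose)
    also have "\<dots> = detn n (\<lambda>i k. q i * exp (- d * x (Suc k)) *
        pseries (bphi \<alpha>) (B' i * (d\<^sup>2 * x (Suc k))))"
      using pos pos_orthant_pos[OF x] assms(1) cd(3)
      by (intro detn_cong) (simp add: besq_density_eq[OF _ _ _ _ d] B'_def[symmetric] q_def mult_ac)
    finally show ?thesis by (simp only: detn_kernel end_fun_def)
  qed
  have r0: "r i \<noteq> 0" for i using cd by (simp add: r_def)
  have q0: "q k \<noteq> 0" if "k < n" for k using cd pos(2)[OF that] by (simp add: q_def)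
  show ?thesis
  proof (rule that)
    show "(\<Prod>i<n. r i) * vand n A' * ((\<Prod>k<n. q k) * vand n B') \<noteq> 0"
      using vand_pos[OF mono(1)] vand_pos[OF mono(2)] r0 q0 by simp
    show "nonint_weight \<alpha> n T t A B x = (\<Prod>i<n. r i) * vand n A' * ((\<Prod>k<n. q k) * vand n B') *
      reduced_weight \<alpha> c d n (\<lambda>j. A (Suc j)) (\<lambda>j. B (Suc j)) x"
      if "x \<in> pos_orthant n" for x
      unfolding nonint_weight_def reduced_weight_def detA[OF that] detB[OF that] A'_def[symmetric] B'_def[symmetric]
      by (simp add: mult_ac)
  qed
qed

lemma nonint_density_eq_ratio:
  assumes "K \<noteq> 0" and "\<And>x. x \<in> pos_orthant n \<Longrightarrow> nonint_weight \<alpha> n T t A B x = K * G x"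
    and "x \<in> pos_orthant n"
  shows "nonint_density \<alpha> n T t A B x = G x / (LINT y:pos_orthant n|lebesgue_n n. G y)"
proof -
  have "(LINT y:pos_orthant n|lebesgue_n n. nonint_weight \<alpha> n T t A B y) =
      (LINT y:pos_orthant n|lebesgue_n n. K * G y)"
    unfolding set_lebesgue_integral_def
    by (intro Bochner_Integration.integral_cong refl) (simp add: indicator_def assms(2))
  then show ?thesis
    using assms by (simp add: nonint_density_def set_integral_mult_right)
qed

lemma confluent_sequence:
  assumes "\<And>s. X s \<in> ordered_configs n \<times> ordered_configs n" and "X \<longlonglongrightarrow> (\<lambda>_. a, \<lambda>_. 0)"
  shows "fst (X s) \<in> ordered_configs n" "snd (X s) \<in> ordered_configs n"
    and "(\<lambda>s. fst (X s) j) \<longlonglongrightarrow> a" "(\<lambda>s. snd (X s) j) \<longlonglongrightarrow> 0"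
proof -
  show "fst (X s) \<in> ordered_configs n" "snd (X s) \<in> ordered_configs n"
    using assms(1)[of s] by (auto simp: mem_Times_iff)
  have coord: "((\<lambda>s. Y s j) \<longlongrightarrow> y j) F" if "(Y \<longlongrightarrow> y) F" for Y y and F :: "nat filter"
    by (rule continuous_on_tendsto_compose[OF continuous_on_product_coordinates that]) auto
  show "(\<lambda>s. fst (X s) j) \<longlonglongrightarrow> a" "(\<lambda>s. snd (X s) j) \<longlonglongrightarrow> 0"
    using coord[OF tendsto_fst[OF assms(2)]] coord[OF tendsto_snd[OF assms(2)]] by simp_all
qed

lemma reduced_weight_dominated:
  fixes U V :: "nat \<Rightarrow> nat \<Rightarrow> real"
  assumes \<alpha>: "-1 < \<alpha>" and cd: "0 < c" "0 < d"
    and U: "\<And>j. (\<lambda>s. U s j) \<longlonglongrightarrow> A j" and V: "\<And>j. (\<lambda>s. V s j) \<longlonglongrightarrow> B j"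
  shows "set_integrable (lebesgue_n n) (pos_orthant n) (reduced_weight \<alpha> c d n A B)"
    and "(\<lambda>s. LINT x:pos_orthant n|lebesgue_n n. reduced_weight \<alpha> c d n (U s) (V s) x)
      \<longlonglongrightarrow> (LINT x:pos_orthant n|lebesgue_n n. reduced_weight \<alpha> c d n A B x)"
    and "x \<in> pos_orthant n \<Longrightarrow>
      (\<lambda>s. reduced_weight \<alpha> c d n (U s) (V s) x) \<longlonglongrightarrow> reduced_weight \<alpha> c d n A B x"
proof -
  interpret pos_entire "bphi \<alpha>" using \<alpha> by (rule pos_entire_bphi)
  \<comment> \<open>The divided differences may use up half of the decay rate \<open>c\<close>, and
    below half of \<open>d\<close>; the other halves keep the majorant integrable.\<close>
  obtain C where C: "\<And>s i x. i < n \<Longrightarrow> 0 < x \<Longrightarrow> \<bar>dd (bphi \<alpha>) (U s) i (c\<^sup>2 * x)\<bar> \<le> C * exp (c / 2 * x)"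
  proof -
    have "\<exists>C\<ge>0. \<forall>s. \<forall>i<n. \<forall>x>0. \<bar>dd (bphi \<alpha>) (U s) i (c\<^sup>2 * x)\<bar> \<le> C * exp (c / 2 * x)"
      using cd convergentI[OF U] by (intro bounded_dd_bphi[OF \<alpha>]) auto
    then show ?thesis using that by blast
  qed
  obtain D where D: "\<And>s i x. i < n \<Longrightarrow> 0 < x \<Longrightarrow> \<bar>dd (bphi \<alpha>) (V s) i (d\<^sup>2 * x)\<bar> \<le> D * exp (d / 2 * x)"
  proof -
    have "\<exists>C\<ge>0. \<forall>s. \<forall>i<n. \<forall>x>0. \<bar>dd (bphi \<alpha>) (V s) i (d\<^sup>2 * x)\<bar> \<le> C * exp (d / 2 * x)"
      using cd convergentI[OF V] by (intro bounded_dd_bphi[OF \<alpha>]) auto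
    then show ?thesis using that by blast
  qed
  define \<beta> where "\<beta> x = x powr \<alpha> * exp (- c * x) * (C * exp (c / 2 * x))" for x
  define \<gamma> where "\<gamma> x = exp (- d * x) * (D * exp (d / 2 * x))" for x
  have meas: "start_fun \<alpha> c A i \<in> borel_measurable borel" "end_fun \<alpha> d A i \<in> borel_measurable borel" for A i
    unfolding start_fun_def[abs_def] end_fun_def[abs_def] by measurable
  have lim: "(\<lambda>s. start_fun \<alpha> c (U s) i x) \<longlonglongrightarrow> start_fun \<alpha> c A i x"
    "(\<lambda>s. end_fun \<alpha> d (V s) i x) \<longlonglongrightarrow> end_fun \<alpha> d B i x" for i x
    unfolding start_fun_def end_fun_def by (intro tendsto_intros tendsto_dd U V)+
  have bound: "\<bar>start_fun \<alpha> c (U s) i x\<bar> \<le> \<beta> x" "\<bar>end_fun \<alpha> d (V s) i x\<bar> \<le> \<gamma> x"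
    if "i < n" "0 < x" for s i x
    unfolding start_fun_def end_fun_def \<beta>_def \<gamma>_def abs_mult
    using C[OF that] D[OF that] by (auto intro!: mult_left_mono)
  have "\<beta> x * \<gamma> x = C * D * (x powr \<alpha> * exp (- ((c + d) / 2) * x))" for x
  proof -
    have "- ((c + d) / 2) * x = - c * x + c / 2 * x + (- d * x + d / 2 * x)"
      by (simp add: field_simps)
    then show ?thesis by (simp only: \<beta>_def \<gamma>_def exp_add) (simp add: mult_ac)
  qed
  then have int: "set_integrable lborel {0<..} (\<lambda>x. \<beta> x * \<gamma> x)"
    using set_integrable_powr_exp[OF \<alpha>, of "(c + d) / 2"] cd
    by (simp only: set_integrable_mult_right) auto
  note * = integral_orthant_dominated[of "\<lambda>s. start_fun \<alpha> c (U s)" "\<lambda>s. end_fun \<alpha> d (V s)"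
    "start_fun \<alpha> c A" "end_fun \<alpha> d B" n \<beta> \<gamma>, OF meas(1) meas(2) meas(1) meas(2) lim bound int,
    folded reduced_weight_def]
  show "set_integrable (lebesgue_n n) (pos_orthant n) (reduced_weight \<alpha> c d n A B)"
    by (rule *(1)) auto
  show "(\<lambda>s. LINT x:pos_orthant n|lebesgue_n n. reduced_weight \<alpha> c d n (U s) (V s) x)
      \<longlonglongrightarrow> (LINT x:pos_orthant n|lebesgue_n n. reduced_weight \<alpha> c d n A B x)"
    by (rule *(2)) auto
  show "(\<lambda>s. reduced_weight \<alpha> c d n (U s) (V s) x) \<longlonglongrightarrow> reduced_weight \<alpha> c d n A B x"
    if "x \<in> pos_orthant n"
    by (rule *(3)) (use that in auto)
qed

text \<open>The confluent end determinant is a positive multiple of \<open>vand n y\<close>. This is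
  the very factor in the lower bound for the start determinant \<open>E\<close>, so the product is
  at least a positive multiple of a squared Vandermonde determinant.\<close>

lemma reduced_weight_confluent_nonneg:
  assumes \<alpha>: "-1 < \<alpha>" and cd: "0 < c" "0 < d" and a: "0 \<le> a" and x: "x \<in> pos_orthant n"
  shows "0 \<le> reduced_weight \<alpha> c d n (\<lambda>_. a) (\<lambda>_. 0) x"
    and "strict_mono_on {1..n} x \<Longrightarrow> 0 < reduced_weight \<alpha> c d n (\<lambda>_. a) (\<lambda>_. 0) x"
proof -
  interpret pos_entire "bphi \<alpha>" using \<alpha> by (rule pos_entire_bphi)
  define y where "y k = x (Suc k)" for k
  have y: "0 < y k" if "k < n" for k using pos_orthant_pos[OF x that] by (simp add: y_def)
  define E where "E = detn n (\<lambda>i k. dd (bphi \<alpha>) (\<lambda>_. a) i (c\<^sup>2 * y k))"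
  define S where "S = (\<Prod>k<n. (c\<^sup>2) ^ k)"
  define L where "L = (\<Prod>k<n. y k powr \<alpha> * exp (- c * y k)) *
    ((\<Prod>i<n. bphi \<alpha> i * (d\<^sup>2) ^ i) * (\<Prod>k<n. exp (- d * y k)))"
  define N where "N = (\<Prod>i<n. bphi \<alpha> i) / fact n * S"
  have S: "0 < S" unfolding S_def using cd by (intro prod_pos) auto
  have L: "0 < L" unfolding L_def using cd y w_pos by (intro mult_pos_pos prod_pos) fastforce+
  have N: "0 < N" unfolding N_def using S w_pos by (intro mult_pos_pos divide_pos_pos prod_pos) auto
  \<comment> \<open>The lower bound is used at the points \<open>c\<^sup>2 * y k\<close>;
    \<open>S\<close> is what this rescaling pulls out of the Vandermonde determinant.\<close>
  have "(\<Prod>i<n. bphi \<alpha> i) / fact n * (S * vand n y)\<^sup>2 \<le> E * (S * vand n y)"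
    unfolding E_def S_def vand_scale[symmetric] using y cd by (intro detn_dd_const_vand_ge a) auto
  then have "S * (N * (vand n y)\<^sup>2) \<le> S * (E * vand n y)"
    by (simp add: N_def power2_eq_square mult_ac)
  then have ge: "N * (vand n y)\<^sup>2 \<le> E * vand n y"
    by (rule mult_left_le_imp_le[OF _ S])
  have "detn n (\<lambda>i k. start_fun \<alpha> c (\<lambda>_. a) i (y k)) = (\<Prod>k<n. y k powr \<alpha> * exp (- c * y k)) * E"
    using detn_scale[of n "\<lambda>_. 1" "\<lambda>k. y k powr \<alpha> * exp (- c * y k)"
        "\<lambda>i k. dd (bphi \<alpha>) (\<lambda>_. a) i (c\<^sup>2 * y k)"]
    by (simp add: start_fun_def E_def)
  moreover have "detn n (\<lambda>i k. end_fun \<alpha> d (\<lambda>_. 0) i (y k)) =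
      (\<Prod>i<n. bphi \<alpha> i * (d\<^sup>2) ^ i) * ((\<Prod>k<n. exp (- d * y k)) * vand n y)"
    unfolding end_fun_def detn_dd_zero detn_power_cols ..
  ultimately have eq: "reduced_weight \<alpha> c d n (\<lambda>_. a) (\<lambda>_. 0) x = L * (E * vand n y)"
    unfolding reduced_weight_def y_def[symmetric] by (simp add: L_def mult_ac)
  have "0 \<le> N * (vand n y)\<^sup>2" using N by simp
  then show "0 \<le> reduced_weight \<alpha> c d n (\<lambda>_. a) (\<lambda>_. 0) x"
    unfolding eq using mult_nonneg_nonneg[of L "E * vand n y"] L ge by linarith
  assume "strict_mono_on {1..n} x"
  then have "0 < vand n y"
    unfolding y_def[abs_def] by (intro vand_pos strict_mono_on_shift)
  then have "0 < N * (vand n y)\<^sup>2" using N by simp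
  then show "0 < reduced_weight \<alpha> c d n (\<lambda>_. a) (\<lambda>_. 0) x"
    unfolding eq using mult_pos_pos[of L "E * vand n y"] L ge by linarith
qed

text \<open>Row \<open>i\<close> is a nonzero multiple of the density of order
  \<open>\<alpha> + i\<close> by \<open>dd_bphi_const\<close>; the recurrence then leaves only the
  orders \<open>\<alpha>\<close> and \<open>\<alpha> + 1\<close>.\<close>

lemma detn_start_fun_const:
  assumes "-1 < \<alpha>" "0 < t" "0 < a" and c: "c = 1 / (2 * t)"
  shows "\<exists>D. D \<noteq> 0 \<and> (\<forall>x\<in>pos_orthant n. detn n (\<lambda>i k. start_fun \<alpha> c (\<lambda>_. a) i (x (Suc k))) =
    D * detn n (\<lambda>i k. x (Suc k) ^ (i div 2) * besq_density (\<alpha> + real (i mod 2)) t a (x (Suc k))))"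
proof -
  obtain D where D: "D \<noteq> 0" "\<And>y. \<forall>k<n. 0 < y k \<Longrightarrow>
    detn n (\<lambda>i k. besq_density (\<alpha> + real i) t a (y k)) =
    D * detn n (\<lambda>i k. y k ^ (i div 2) * besq_density (\<alpha> + real (i mod 2)) t a (y k))"
    using detn_besq_orders[OF assms(1-3), of n] by blast
  define r where "r i = c ^ i / fact i / (c powr (\<alpha> + 1) * exp (- c * a))" for i
  have cp: "0 < c" using assms by simp
  have "start_fun \<alpha> c (\<lambda>_. a) i y = r i * besq_density (\<alpha> + real i) t a y" if "0 < y" for i y
  proof -
    have p: "c powr (\<alpha> + real i + 1) = c powr (\<alpha> + 1) * c ^ i" "y powr (\<alpha> + real i) = y powr \<alpha> * y ^ i"
      using cp that by (simp_all add: powr_add powr_realpow)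
    show ?thesis
      using assms(1-3) that cp
      by (subst besq_density_eq[OF _ _ _ _ c])
         (simp_all add: p start_fun_def r_def dd_bphi_const power_mult_distrib power2_eq_square mult_ac)
  qed
  then have "detn n (\<lambda>i k. start_fun \<alpha> c (\<lambda>_. a) i (x (Suc k))) =
      detn n (\<lambda>i k. r i * 1 * besq_density (\<alpha> + real i) t a (x (Suc k)))" if "x \<in> pos_orthant n" for x
    using pos_orthant_pos[OF that] by (intro detn_cong) simp
  then have "detn n (\<lambda>i k. start_fun \<alpha> c (\<lambda>_. a) i (x (Suc k))) = (\<Prod>i<n. r i) * D *
      detn n (\<lambda>i k. x (Suc k) ^ (i div 2) * besq_density (\<alpha> + real (i mod 2)) t a (x (Suc k)))"
    if "x \<in> pos_orthant n" for x
    unfolding detn_scale using D(2)[of "\<lambda>k. x (Suc k)"] pos_orthant_pos[OF that] that by simp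
  moreover have "(\<Prod>i<n. r i) * D \<noteq> 0" using D(1) cp by (simp add: r_def)
  ultimately show ?thesis by blast
qed

theorem proposition2p1:
  fixes \<alpha> T t a :: real and n n1 n2 :: nat and f g :: "nat \<Rightarrow> real \<Rightarrow> real"
  assumes "\<alpha> > -1" and "0 < t" and "t < T" and "a > 0"
    and "n1 = nat \<lceil>real n / 2\<rceil>" and "n2 = n - n1"
    and "\<And>j. j \<in> {1..n1} \<Longrightarrow> f (2 * j - 1) = (\<lambda>x. x ^ (j - 1) * besq_density \<alpha> t a x)"
    and "\<And>j. j \<in> {1..n2} \<Longrightarrow> f (2 * j) = (\<lambda>x. x ^ (j - 1) * besq_density (\<alpha> + 1) t a x)"
    and "\<And>j. j \<in> {1..n} \<Longrightarrow> g j = (\<lambda>x. x ^ (j - 1) * exp (- x / (2 * (T - t))))"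
  shows "\<exists>P. biorthogonal_ensemble n f g P \<and>
    (\<forall>x\<in>pos_orthant n.
      ((\<lambda>(A, B). nonint_density \<alpha> n T t A B x) \<longlongrightarrow> P x) (confluent n a))"
proof -
  define c d where "c = 1 / (2 * t)" and "d = 1 / (2 * (T - t))"
  have cd: "0 < c" "0 < d" using assms(2,3) by (simp_all add: c_def d_def)
  define G where "G = reduced_weight \<alpha> c d n (\<lambda>_. a) (\<lambda>_. 0)"
  define I where "I = (LINT x:pos_orthant n|lebesgue_n n. G x)"
  have G_int: "set_integrable (lebesgue_n n) (pos_orthant n) G"
    unfolding G_def
    by (rule reduced_weight_dominated(1)[OF assms(1) cd, of "\<lambda>_ _. a" _ "\<lambda>_ _. 0"]) auto
  have G_nonneg: "0 \<le> G x" if "x \<in> pos_orthant n" for x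
    unfolding G_def
    using reduced_weight_confluent_nonneg(1)[OF assms(1) cd less_imp_le[OF assms(4)] that] .
  \<comment> \<open>The positive mass of the limit permits dividing by the limit of the
    normalization integrals.\<close>
  have I: "0 < I"
    unfolding I_def using G_int G_nonneg
  proof (rule integral_orthant_pos)
    show "0 < G x" if "x \<in> pos_orthant n" "strict_mono_on {1..n} x" for x
      unfolding G_def
      using reduced_weight_confluent_nonneg(2)[OF assms(1) cd less_imp_le[OF assms(4)] that] .
  qed

  \<comment> \<open>Counting rows from 0 merges the odd and even members of the family: the exponent
    is \<open>m div 2\<close>, and the parity of \<open>m\<close> selects the order.\<close>
  have f: "f (Suc m) = (\<lambda>x. x ^ (m div 2) * besq_density (\<alpha> + real (m mod 2)) t a x)" if "m < n" for m
  proof -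
    have n1: "n1 = (n + 1) div 2"
    proof (cases "even n")
      case True
      then show ?thesis unfolding assms(5) by (elim evenE) simp
    next
      case False
      then obtain k where k: "n = 2 * k + 1" by (elim oddE)
      have "\<lceil>real n / 2\<rceil> = int k + 1" by (rule ceiling_unique) (simp_all add: k)
      then show ?thesis by (simp add: assms(5) k nat_add_distrib)
    qed
    show ?thesis
    proof (cases "even m")
      case True
      then obtain l where l: "m = 2 * l" by (elim evenE)
      have "Suc l \<in> {1..n1}" using that by (auto simp: n1 l)
      from assms(7)[OF this] show ?thesis by (simp add: l)
    next
      case False
      then obtain l where l: "m = 2 * l + 1" by (elim oddE)
      have "Suc l \<in> {1..n2}" using that by (auto simp: assms(6) n1 l)
      from assms(8)[OF this] show ?thesis by (simp add: l)
    qed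
  qed
  obtain D where D: "D \<noteq> 0" "\<And>x. x \<in> pos_orthant n \<Longrightarrow>
      detn n (\<lambda>i k. start_fun \<alpha> c (\<lambda>_. a) i (x (Suc k))) =
      D * detn n (\<lambda>i k. x (Suc k) ^ (i div 2) * besq_density (\<alpha> + real (i mod 2)) t a (x (Suc k)))"
    using detn_start_fun_const[OF assms(1,2,4) c_def, of n] by blast
  have detf: "detn n (\<lambda>i k. start_fun \<alpha> c (\<lambda>_. a) i (x (Suc k))) = D * det1 n (\<lambda>j k. f j (x k))"
    if "x \<in> pos_orthant n" for x
  proof -
    have "det1 n (\<lambda>j k. f j (x k)) =
        detn n (\<lambda>i k. x (Suc k) ^ (i div 2) * besq_density (\<alpha> + real (i mod 2)) t a (x (Suc k)))"
      unfolding det1_eq_detn by (rule detn_cong) (simp only: f)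
    then show ?thesis by (simp only: D(2)[OF that])
  qed
  define E where "E = (\<Prod>i<n. bphi \<alpha> i * (d\<^sup>2) ^ i)"
  have "0 < E"
    unfolding E_def using cd by (intro prod_pos ballI mult_pos_pos bphi_pos assms(1)) simp
  have detg: "detn n (\<lambda>i k. end_fun \<alpha> d (\<lambda>_. 0) i (x (Suc k))) = E * det1 n (\<lambda>j k. g j (x k))" for x
  proof -
    have "det1 n (\<lambda>j k. g j (x k)) = detn n (\<lambda>i k. x (Suc k) ^ i * exp (- d * x (Suc k)))"
      unfolding det1_eq_detn by (rule detn_cong) (simp add: assms(9) d_def)
    then show ?thesis by (simp only: end_fun_def detn_dd_zero E_def)
  qed

  have "biorthogonal_ensemble n f g (\<lambda>x. 1 / I * G x)"
    unfolding biorthogonal_ensemble_def prob_density_on_orthant_def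
  \<comment> \<open>\<open>G\<close> is \<open>D * E\<close> times the product of the two
    determinants and has mass \<open>I\<close>, which fixes the constant.\<close>
  proof (intro conjI ballI exI[of _ "I / (D * E)"])
    show "0 \<le> 1 / I * G x" if "x \<in> pos_orthant n" for x
      using G_nonneg[OF that] I by simp
    show "set_integrable (lebesgue_n n) (pos_orthant n) (\<lambda>x. 1 / I * G x)"
      using G_int by (intro set_integrable_mult_right)
    show "(LINT x:pos_orthant n|lebesgue_n n. 1 / I * G x) = 1"
      using I unfolding set_integral_mult_right I_def by simp
    show "I / (D * E) \<noteq> 0" using I D(1) \<open>0 < E\<close> by simp
    show "1 / I * G x = 1 / (I / (D * E)) * det1 n (\<lambda>j k. f j (x k)) * det1 n (\<lambda>j k. g j (x k))"
      if "x \<in> pos_orthant n" for x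
      unfolding G_def reduced_weight_def detf[OF that] detg by simp
  qed
  moreover have "((\<lambda>(A, B). nonint_density \<alpha> n T t A B x) \<longlongrightarrow> 1 / I * G x) (confluent n a)"
    if x: "x \<in> pos_orthant n" for x
    \<comment> \<open>Pointwise convergence on a countable index set is first countable, so
      sequences suffice and dominated convergence applies.\<close>
    unfolding confluent_def tendsto_at_iff_sequentially
  proof (intro allI impI)
    fix X :: "nat \<Rightarrow> (nat \<Rightarrow> real) \<times> (nat \<Rightarrow> real)"
    assume "\<forall>s. X s \<in> ordered_configs n \<times> ordered_configs n - {(\<lambda>_. a, \<lambda>_. 0)}"
    then have mem: "X s \<in> ordered_configs n \<times> ordered_configs n" for s by blast
    assume lim: "X \<longlonglongrightarrow> (\<lambda>_. a, \<lambda>_. 0)"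
    note X = confluent_sequence[OF mem lim]
    define W where "W s = reduced_weight \<alpha> c d n (\<lambda>j. fst (X s) (Suc j)) (\<lambda>j. snd (X s) (Suc j))" for s
    \<comment> \<open>The factor \<open>K\<close> varies with \<open>s\<close>, but it cancels
      within each density separately.\<close>
    have "nonint_density \<alpha> n T t (fst (X s)) (snd (X s)) x =
        W s x / (LINT y:pos_orthant n|lebesgue_n n. W s y)" for s
    proof -
      obtain K where "K \<noteq> 0" "\<And>y. y \<in> pos_orthant n \<Longrightarrow>
          nonint_weight \<alpha> n T t (fst (X s)) (snd (X s)) y = K * W s y"
        unfolding W_def
        by (rule nonint_weight_factor[OF assms(1-3) X(1,2) c_def d_def, of s s]) blast
      then show ?thesis by (intro nonint_density_eq_ratio x)
    qed
    moreover have "(\<lambda>s. W s x / (LINT y:pos_orthant n|lebesgue_n n. W s y)) \<longlonglongrightarrow> G x / I"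
      unfolding W_def I_def G_def
      using I by (intro tendsto_divide reduced_weight_dominated(2,3)[OF assms(1) cd] X(3,4) x)
        (simp add: I_def G_def)
    ultimately show "((\<lambda>(A, B). nonint_density \<alpha> n T t A B x) \<circ> X) \<longlonglongrightarrow> 1 / I * G x"
      by (simp add: o_def case_prod_unfold)
  qed
  ultimately show ?thesis by blast
qed

end
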